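(* Let $(G,\mathfrak{A})$ be an averaging Lie group with identity element $e$ such that $\mathfrak{A}(e)=e$. Let $\mathfrak{g}=T_eG$ be the Lie algebra of $G$, and let $A:=\mathfrak{A}_{*e}:\mathfrak{g}\to\mathfrak{g}$ be the tangent map (differential) of $\mathfrak{A}$ at $e$. Then $(\mathfrak{g},A)$ is an averaging Lie algebra.
   Context: An averaging group is a pair $(G,\mathfrak{A})$ where $G$ is a group and $\mathfrak{A}:G\to G$ is a map (not necessarily a homomorphism), called an averaging operator, such that $\mathfrak{A}(g)\mathfrak{A}(h)=\mathfrak{A}(\mathfrak{A}(g)h)=\mathfrak{A}(g\mathfrak{A}(h))$ for all $g,h\in G$. It is called an averaging Lie group if moreover $G$ is a Lie group and $\mathfrak{A}$ is smooth. An averaging Lie algebra is a Lie algebra $(L,[\,,\,])$ together with a linear operator $A:L\to L$ such that $[A(a),A(b)]=A([A(a),b])$ for all $a,b\in L$. *)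

theory Defs
  imports "HOL-Analysis.Analysis" "HOL-Algebra.Algebraic_Closure_Type"
begin

section \<open>Smooth maps between open subsets of finite-dimensional spaces\<close>

text \<open>
  \<open>Ck_on k S f\<close> is meant for open \<open>S\<close> and finite-dimensional domains. There, being k times
  continuously differentiable is the same as being differentiable with all directional derivatives
  k - 1 times continuously differentiable (let the direction run through a basis).
\<close>

primrec Ck_on ::
  "nat \<Rightarrow> 'a::real_normed_vector set \<Rightarrow> ('a \<Rightarrow> 'b::real_normed_vector) \<Rightarrow> bool" where
  "Ck_on 0 S f \<longleftrightarrow> continuous_on S f"
| "Ck_on (Suc k) S f \<longleftrightarrow> (\<forall>x\<in>S. f differentiable (at x)) \<and>
     (\<forall>v. Ck_on k S (\<lambda>x. frechet_derivative f (at x) v))"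

definition smooth_on ::
  "'a::real_normed_vector set \<Rightarrow> ('a \<Rightarrow> 'b::real_normed_vector) \<Rightarrow> bool" where
  "smooth_on S f \<longleftrightarrow> (\<forall>k. Ck_on k S f)"


section \<open>Smooth manifolds\<close>

text \<open>
  A chart is a pair \<open>(U, \<phi>)\<close>; only the values of \<open>\<phi>\<close> on \<open>U\<close> matter. The smooth structure is given by
  an atlas, which need not be maximal. The model space is a finite-dimensional real inner product
  space; the class \<open>euclidean_space\<close> is avoided because it excludes dimension 0, that is, discrete
  Lie groups.
\<close>

record ('a, 'e) mfd =
  mtop :: "'a topology"
  atlas :: "('a set \<times> ('a \<Rightarrow> 'e)) set"

locale smooth_manifold =
  fixes M :: "('a, 'e::real_inner) mfd"
  assumes finite_dimensional: "\<exists>B :: 'e set. finite B \<and> span B = UNIV"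
    and Hausdorff: "Hausdorff_space (mtop M)"
    and second_countable: "second_countable (mtop M)"
    and charts_cover: "(\<Union>(U, \<phi>)\<in>atlas M. U) = topspace (mtop M)"
    and chart_domain_open: "(U, \<phi>) \<in> atlas M \<Longrightarrow> openin (mtop M) U"
    and chart_image_open: "(U, \<phi>) \<in> atlas M \<Longrightarrow> open (\<phi> ` U)"
    and chart_homeomorphism: "(U, \<phi>) \<in> atlas M \<Longrightarrow>
      homeomorphic_map (subtopology (mtop M) U) (top_of_set (\<phi> ` U)) \<phi>"
    and transition_smooth: "(U, \<phi>) \<in> atlas M \<Longrightarrow> (V, \<psi>) \<in> atlas M \<Longrightarrow>
      smooth_on (\<phi> ` (U \<inter> V)) (\<psi> \<circ> inv_into U \<phi>)"

definition smooth_map ::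
  "('a, 'e::real_inner) mfd \<Rightarrow> ('b, 'f::real_inner) mfd \<Rightarrow> ('a \<Rightarrow> 'b) \<Rightarrow> bool" where
  "smooth_map M N F \<longleftrightarrow> continuous_map (mtop M) (mtop N) F \<and>
     (\<forall>(U, \<phi>)\<in>atlas M. \<forall>(V, \<psi>)\<in>atlas N.
        smooth_on (\<phi> ` (U \<inter> F -` V)) (\<psi> \<circ> F \<circ> inv_into U \<phi>))"

definition prod_mfd ::
  "('a, 'e::real_inner) mfd \<Rightarrow> ('b, 'f::real_inner) mfd \<Rightarrow> ('a \<times> 'b, 'e \<times> 'f) mfd" where
  "prod_mfd M N =
     \<lparr>mtop = prod_topology (mtop M) (mtop N),
      atlas = {(U \<times> V, map_prod \<phi> \<psi>) | U \<phi> V \<psi>. (U, \<phi>) \<in> atlas M \<and> (V, \<psi>) \<in> atlas N}\<rparr>"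

definition smooth_near :: "('a, 'e::real_inner) mfd \<Rightarrow> 'a \<Rightarrow> ('a \<Rightarrow> real) \<Rightarrow> bool" where
  "smooth_near M p f \<longleftrightarrow> (\<exists>W. openin (mtop M) W \<and> p \<in> W \<and>
     (\<forall>(U, \<phi>)\<in>atlas M. smooth_on (\<phi> ` (U \<inter> W)) (f \<circ> inv_into U \<phi>)))"


section \<open>Tangent spaces and differentials\<close>

text \<open>
  Tangent vectors at \<open>p\<close> are the derivations at \<open>p\<close> of the germs of smooth functions. They are
  represented as functionals on all functions that are smooth near \<open>p\<close>. Such a functional depends on
  the germ only: if \<open>f\<close> and \<open>g\<close> agree on an open \<open>W\<close> around \<open>p\<close>, then the indicator \<open>h\<close> of \<open>W\<close> is smooth
  near \<open>p\<close>, and \<open>(f - g) * h = 0\<close> gives \<open>D f = D g\<close> by the Leibniz rule. The value 0 on functions that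
  are not smooth near \<open>p\<close> is a convention making the representation unique.
\<close>

definition tangent_space :: "('a, 'e::real_inner) mfd \<Rightarrow> 'a \<Rightarrow> (('a \<Rightarrow> real) \<Rightarrow> real) set" where
  "tangent_space M p = {D.
     (\<forall>f. \<not> smooth_near M p f \<longrightarrow> D f = 0) \<and>
     (\<forall>f g. smooth_near M p f \<longrightarrow> smooth_near M p g \<longrightarrow> D (\<lambda>x. f x + g x) = D f + D g) \<and>
     (\<forall>c f. smooth_near M p f \<longrightarrow> D (\<lambda>x. c * f x) = c * D f) \<and>
     (\<forall>f g. smooth_near M p f \<longrightarrow> smooth_near M p g \<longrightarrow>
        D (\<lambda>x. f x * g x) = f p * D g + g p * D f)}"

text \<open>
  The record type \<open>module\<close> extends the one of rings; \<open>mult\<close> and \<open>one\<close> play no role for a vector space.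
\<close>

definition tangent_module ::
  "('a, 'e::real_inner) mfd \<Rightarrow> 'a \<Rightarrow> (real, ('a \<Rightarrow> real) \<Rightarrow> real) module" where
  "tangent_module M p =
     \<lparr>carrier = tangent_space M p, mult = undefined, one = undefined,
      zero = (\<lambda>f. 0), add = (\<lambda>u v f. u f + v f), smult = (\<lambda>c u f. c * u f)\<rparr>"

definition differential ::
  "('a, 'e::real_inner) mfd \<Rightarrow> ('b, 'f::real_inner) mfd \<Rightarrow> ('a \<Rightarrow> 'b) \<Rightarrow> 'a \<Rightarrow>
   (('a \<Rightarrow> real) \<Rightarrow> real) \<Rightarrow> (('b \<Rightarrow> real) \<Rightarrow> real)" where
  "differential M N F p u = (\<lambda>f. if smooth_near N (F p) f then u (f \<circ> F) else 0)"

text \<open>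
  A vector field \<open>V\<close> assigns to \<open>q\<close> a tangent vector \<open>V q\<close>, so \<open>\<lambda>q. V q f\<close> is the function \<open>V f\<close>, and
  the bracket is \<open>[V, W] f = V (W f) - W (V f)\<close> at the point \<open>p\<close>.
\<close>

definition vector_field_bracket ::
  "('a, 'e::real_inner) mfd \<Rightarrow> ('a \<Rightarrow> ('a \<Rightarrow> real) \<Rightarrow> real) \<Rightarrow> ('a \<Rightarrow> ('a \<Rightarrow> real) \<Rightarrow> real) \<Rightarrow>
   'a \<Rightarrow> (('a \<Rightarrow> real) \<Rightarrow> real)" where
  "vector_field_bracket M V W p =
     (\<lambda>f. if smooth_near M p f then V p (\<lambda>q. W q f) - W p (\<lambda>q. V q f) else 0)"


section \<open>Lie groups and the bracket on the tangent space at the identity\<close>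

locale lie_group = group G + smooth_manifold M
  for G :: "('a, 'm) monoid_scheme" (structure) and M :: "('a, 'e::real_inner) mfd" +
  assumes topspace_eq_carrier: "topspace (mtop M) = carrier G"
    and smooth_mult: "smooth_map (prod_mfd M M) M (\<lambda>(x, y). x \<otimes> y)"
    and smooth_inv: "smooth_map M M (\<lambda>x. inv x)"

definition left_invariant_field ::
  "('a, 'm) monoid_scheme \<Rightarrow> ('a, 'e::real_inner) mfd \<Rightarrow> (('a \<Rightarrow> real) \<Rightarrow> real) \<Rightarrow>
   'a \<Rightarrow> (('a \<Rightarrow> real) \<Rightarrow> real)" where
  "left_invariant_field G M u g = differential M M (\<lambda>h. g \<otimes>\<^bsub>G\<^esub> h) \<one>\<^bsub>G\<^esub> u"

definition lie_bracket ::
  "('a, 'm) monoid_scheme \<Rightarrow> ('a, 'e::real_inner) mfd \<Rightarrow>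
   (('a \<Rightarrow> real) \<Rightarrow> real) \<Rightarrow> (('a \<Rightarrow> real) \<Rightarrow> real) \<Rightarrow> (('a \<Rightarrow> real) \<Rightarrow> real)" where
  "lie_bracket G M u v =
     vector_field_bracket M (left_invariant_field G M u) (left_invariant_field G M v) \<one>\<^bsub>G\<^esub>"


section \<open>Lie algebras\<close>

locale lie_algebra = field K + Module.module K L
  for K :: "('k, 'm) ring_scheme" (structure) and L :: "('k, 'v, 'n) module_scheme" (structure) +
  fixes bracket :: "'v \<Rightarrow> 'v \<Rightarrow> 'v"
  assumes bracket_closed:
      "x \<in> carrier L \<Longrightarrow> y \<in> carrier L \<Longrightarrow> bracket x y \<in> carrier L"
    and bracket_add_left:
      "x \<in> carrier L \<Longrightarrow> y \<in> carrier L \<Longrightarrow> z \<in> carrier L \<Longrightarrow>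
       bracket (x \<oplus>\<^bsub>L\<^esub> y) z = bracket x z \<oplus>\<^bsub>L\<^esub> bracket y z"
    and bracket_add_right:
      "x \<in> carrier L \<Longrightarrow> y \<in> carrier L \<Longrightarrow> z \<in> carrier L \<Longrightarrow>
       bracket x (y \<oplus>\<^bsub>L\<^esub> z) = bracket x y \<oplus>\<^bsub>L\<^esub> bracket x z"
    and bracket_smult_left:
      "c \<in> carrier K \<Longrightarrow> x \<in> carrier L \<Longrightarrow> y \<in> carrier L \<Longrightarrow>
       bracket (c \<odot>\<^bsub>L\<^esub> x) y = c \<odot>\<^bsub>L\<^esub> bracket x y"
    and bracket_smult_right:
      "c \<in> carrier K \<Longrightarrow> x \<in> carrier L \<Longrightarrow> y \<in> carrier L \<Longrightarrow>
       bracket x (c \<odot>\<^bsub>L\<^esub> y) = c \<odot>\<^bsub>L\<^esub> bracket x y"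
    and bracket_self:
      "x \<in> carrier L \<Longrightarrow> bracket x x = \<zero>\<^bsub>L\<^esub>"
    and jacobi:
      "x \<in> carrier L \<Longrightarrow> y \<in> carrier L \<Longrightarrow> z \<in> carrier L \<Longrightarrow>
       bracket x (bracket y z) \<oplus>\<^bsub>L\<^esub> bracket y (bracket z x) \<oplus>\<^bsub>L\<^esub> bracket z (bracket x y) = \<zero>\<^bsub>L\<^esub>"


section \<open>Averaging groups and averaging Lie algebras\<close>

locale averaging_group = group G for G :: "('a, 'm) monoid_scheme" (structure) +
  fixes Av :: "'a \<Rightarrow> 'a"
  assumes averaging_closed: "Av \<in> carrier G \<rightarrow> carrier G"
    and averaging_left:
      "g \<in> carrier G \<Longrightarrow> h \<in> carrier G \<Longrightarrow> Av g \<otimes> Av h = Av (Av g \<otimes> h)"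
    and averaging_right:
      "g \<in> carrier G \<Longrightarrow> h \<in> carrier G \<Longrightarrow> Av g \<otimes> Av h = Av (g \<otimes> Av h)"

locale averaging_lie_group = averaging_group G Av + lie_group G M
  for G :: "('a, 'm) monoid_scheme" (structure) and M :: "('a, 'e::real_inner) mfd"
    and Av :: "'a \<Rightarrow> 'a" +
  assumes averaging_smooth: "smooth_map M M Av"

locale averaging_lie_algebra = lie_algebra K L bracket
  for K :: "('k, 'm) ring_scheme" (structure) and L :: "('k, 'v, 'n) module_scheme" (structure)
    and bracket :: "'v \<Rightarrow> 'v \<Rightarrow> 'v" and A :: "'v \<Rightarrow> 'v" +
  assumes operator_closed: "A \<in> carrier L \<rightarrow> carrier L"
    and operator_add: "x \<in> carrier L \<Longrightarrow> y \<in> carrier L \<Longrightarrow> A (x \<oplus>\<^bsub>L\<^esub> y) = A x \<oplus>\<^bsub>L\<^esub> A y"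
    and operator_smult: "c \<in> carrier K \<Longrightarrow> x \<in> carrier L \<Longrightarrow> A (c \<odot>\<^bsub>L\<^esub> x) = c \<odot>\<^bsub>L\<^esub> A x"
    and averaging_identity:
      "x \<in> carrier L \<Longrightarrow> y \<in> carrier L \<Longrightarrow> bracket (A x) (A y) = A (bracket (A x) y)"

end

theory Submission
  imports Defs
begin

text \<open>
  Write \<open>u\<^sub>x F(x)\<close> for the value of a tangent vector \<open>u\<close> at the identity on a function of \<open>x\<close>. The left
  invariant field of \<open>v\<close> sends \<open>f\<close> to the function \<open>q \<mapsto> v\<^sub>y f(qy)\<close>, so that
  \<open>[u,v] f = u\<^sub>x v\<^sub>y f(xy) - v\<^sub>x u\<^sub>y f(xy)\<close>. The differential acts by \<open>(A u) f = u\<^sub>x f(a(x))\<close>,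
  where \<open>a\<close> is the averaging operator. Since \<open>a\<close> fixes the identity, both sides of the averaging
  identity are functionals at the identity, and they can be compared on one \<open>f\<close>:
  \<open>[A u, A v] f = u\<^sub>x v\<^sub>y f(a(x) a(y)) - v\<^sub>x u\<^sub>y f(a(x) a(y))\<close> and
  \<open>A [A u, v] f = u\<^sub>x v\<^sub>y f(a(a(x) y)) - v\<^sub>x u\<^sub>y f(a(x a(y)))\<close>.
  The two group identities of an averaging operator make the corresponding terms equal
  (\<open>averaging_bracket_identity\<close>).

  The Lie algebra axioms come from the same formula. In \<open>[u,v](f g)\<close> the cross terms
  \<open>u f * v g + u g * v f\<close> cancel, so \<open>[u,v]\<close> is again a derivation; by associativity the left
  invariant field of \<open>[u,v]\<close> is the commutator of those of \<open>u\<close> and \<open>v\<close>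
  (\<open>tangent_lderiv_lie_bracket\<close>), and the Jacobi identity for commutators finishes.

  All this needs that \<open>q \<mapsto> v\<^sub>y f(qy)\<close> is smooth near the identity, and an abstract derivation \<open>v\<close> does
  not obviously respect smooth dependence on a parameter. Hadamard's lemma (\<open>hadamard_expansion\<close>) shows
  that \<open>v\<close> is a directional derivative in a chart (\<open>tangent_eq_directional_derivative\<close>); then
  \<open>q \<mapsto> v\<^sub>y f(qy)\<close> is a partial derivative of a function that is smooth in both variables
  (\<open>smooth_fun_on_tangent_slice\<close>).
\<close>

section \<open>Calculus of k times continuously differentiable maps\<close>

lemma Ck_on_subset: "Ck_on k S f \<Longrightarrow> T \<subseteq> S \<Longrightarrow> Ck_on k T f"
  by (induction k arbitrary: f) (auto intro: continuous_on_subset)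

lemma frechet_derivative_cong_open:
  assumes "open S" "x \<in> S" "\<And>y. y \<in> S \<Longrightarrow> f y = g y"
  shows "frechet_derivative f (at x) = frechet_derivative g (at x)"
proof -
  have "(f has_derivative D) (at x) \<longleftrightarrow> (g has_derivative D) (at x)" for D
    using assms by (metis has_derivative_transform_within_open)
  then show ?thesis by (simp add: frechet_derivative_def)
qed

lemma differentiable_cong_open:
  assumes "open S" "x \<in> S" "\<And>y. y \<in> S \<Longrightarrow> f y = g y"
  shows "f differentiable (at x) \<longleftrightarrow> g differentiable (at x)"
  using assms unfolding differentiable_def by (metis has_derivative_transform_within_open)

lemma Ck_on_cong:
  assumes "open S" "\<And>x. x \<in> S \<Longrightarrow> f x = g x"
  shows "Ck_on k S f \<longleftrightarrow> Ck_on k S g"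
  using assms(2)
proof (induction k arbitrary: f g)
  case 0
  then show ?case by (simp cong: continuous_on_cong)
next
  case (Suc k)
  have "Ck_on k S (\<lambda>x. frechet_derivative f (at x) v) \<longleftrightarrow>
        Ck_on k S (\<lambda>x. frechet_derivative g (at x) v)" for v
    by (rule Suc.IH) (use Suc.prems assms(1) frechet_derivative_cong_open in metis)
  moreover have "f differentiable (at x) \<longleftrightarrow> g differentiable (at x)" if "x \<in> S" for x
    using assms(1) Suc.prems that by (intro differentiable_cong_open) auto
  ultimately show ?case by simp
qed

lemma Ck_on_locally:
  assumes "\<And>x. x \<in> S \<Longrightarrow> \<exists>T. open T \<and> x \<in> T \<and> Ck_on k T f"
  shows "Ck_on k S f"
  using assms
proof (induction k arbitrary: f)
  case 0
  have "isCont f x" if "x \<in> S" for x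
    using 0[OF that] by (auto simp: continuous_on_eq_continuous_at)
  then show ?case by (simp add: continuous_at_imp_continuous_on)
next
  case (Suc k)
  have "Ck_on k S (\<lambda>x. frechet_derivative f (at x) v)" for v
    by (rule Suc.IH) (use Suc.prems in fastforce)
  then show ?case using Suc.prems by fastforce
qed

lemma Ck_on_Suc_imp: "Ck_on (Suc k) S f \<Longrightarrow> Ck_on k S f"
proof (induction k arbitrary: f)
  case 0
  then show ?case
    by (auto intro!: continuous_at_imp_continuous_on differentiable_imp_continuous_within)
next
  case (Suc k)
  show ?case
    unfolding Ck_on.simps(2)[of k] using Suc.prems Suc.IH unfolding Ck_on.simps(2)[of "Suc k"] by blast
qed

lemma Ck_on_imp_continuous_on: "Ck_on k S f \<Longrightarrow> continuous_on S f"
proof (induction k)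
  case (Suc k)
  then show ?case using Ck_on_Suc_imp by blast
qed simp

lemma Ck_on_const: "Ck_on k S (\<lambda>x. c)"
  by (induction k arbitrary: c) simp_all

text \<open>
  Introduction rule that replaces the chosen derivative \<open>frechet_derivative\<close> by any explicit one. All
  closure properties below are inductions over the order of differentiability that use it with the
  usual formula for the derivative.
\<close>

lemma Ck_on_SucI:
  assumes "open S" and D: "\<And>x. x \<in> S \<Longrightarrow> (f has_derivative D x) (at x)"
    and "\<And>v. Ck_on k S (\<lambda>x. D x v)"
  shows "Ck_on (Suc k) S f"
proof -
  have "Ck_on k S (\<lambda>x. frechet_derivative f (at x) v)" for v
    using Ck_on_cong[OF assms(1), of "\<lambda>x. D x v" "\<lambda>x. frechet_derivative f (at x) v" k]
      assms(3) frechet_derivative_at[OF D] by metis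
  moreover have "f differentiable (at x)" if "x \<in> S" for x
    using D[OF that] by (auto simp: differentiable_def)
  ultimately show ?thesis by simp
qed

lemma Ck_on_Suc_has_derivative:
  "Ck_on (Suc k) S f \<Longrightarrow> x \<in> S \<Longrightarrow> (f has_derivative frechet_derivative f (at x)) (at x)"
  by (simp add: frechet_derivative_works)

lemma Ck_on_bounded_linear_comp:
  assumes "open S" "bounded_linear h" "Ck_on k S f"
  shows "Ck_on k S (\<lambda>x. h (f x))"
  using assms(3)
proof (induction k arbitrary: f)
  case 0
  then show ?case
    using assms(2) by (auto intro: bounded_linear.continuous_on)
next
  case (Suc k)
  show ?case
  proof (rule Ck_on_SucI[OF assms(1)])
    show "((\<lambda>x. h (f x)) has_derivative (\<lambda>v. h (frechet_derivative f (at x) v))) (at x)"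
      if "x \<in> S" for x
      by (intro bounded_linear.has_derivative[OF assms(2)] Ck_on_Suc_has_derivative[OF Suc.prems that])
    show "Ck_on k S (\<lambda>x. h (frechet_derivative f (at x) v))" for v
      using Suc by simp
  qed
qed

lemma Ck_on_add:
  assumes "open S" "Ck_on k S f" "Ck_on k S g"
  shows "Ck_on k S (\<lambda>x. f x + g x)"
  using assms(2,3)
proof (induction k arbitrary: f g)
  case 0
  then show ?case by (auto intro: continuous_on_add)
next
  case (Suc k)
  show ?case
  proof (rule Ck_on_SucI[OF assms(1)])
    show "((\<lambda>x. f x + g x) has_derivative
        (\<lambda>v. frechet_derivative f (at x) v + frechet_derivative g (at x) v)) (at x)"
      if "x \<in> S" for x
      using that Suc.prems by (intro has_derivative_add Ck_on_Suc_has_derivative)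
    show "Ck_on k S (\<lambda>x. frechet_derivative f (at x) v + frechet_derivative g (at x) v)" for v
      using Suc by simp
  qed
qed

lemma Ck_on_sum:
  assumes "open S" "\<And>i. i \<in> I \<Longrightarrow> Ck_on k S (f i)"
  shows "Ck_on k S (\<lambda>x. \<Sum>i\<in>I. f i x)"
  using assms(2)
  by (induction I rule: infinite_finite_induct) (auto simp: Ck_on_const intro!: Ck_on_add assms(1))

lemma Ck_on_scaleR:
  assumes "open S" "Ck_on k S f" "Ck_on k S g"
  shows "Ck_on k S (\<lambda>x. f x *\<^sub>R g x)"
  using assms(2,3)
proof (induction k arbitrary: f g)
  case 0
  then show ?case by (auto intro: continuous_on_scaleR)
next
  case (Suc k)
  note low = Suc.prems[THEN Ck_on_Suc_imp]
  show ?case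
  proof (rule Ck_on_SucI[OF assms(1)])
    show "((\<lambda>x. f x *\<^sub>R g x) has_derivative
        (\<lambda>v. f x *\<^sub>R frechet_derivative g (at x) v + frechet_derivative f (at x) v *\<^sub>R g x)) (at x)"
      if "x \<in> S" for x
      using that Suc.prems by (intro has_derivative_scaleR Ck_on_Suc_has_derivative)
    show "Ck_on k S (\<lambda>x. f x *\<^sub>R frechet_derivative g (at x) v + frechet_derivative f (at x) v *\<^sub>R g x)" for v
      using Suc.prems low by (intro Ck_on_add Suc.IH assms(1)) auto
  qed
qed

text \<open>
  A finite set that reproduces each vector from its inner products, as an orthonormal basis does, gives
  continuous coordinates on any finite-dimensional inner product space, the zero space included.
\<close>

definition parseval_frame :: "'b::real_inner set \<Rightarrow> bool" where
  "parseval_frame C \<longleftrightarrow> finite C \<and> (\<forall>x. (\<Sum>c\<in>C. (x \<bullet> c) *\<^sub>R c) = x)"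

lemma parseval_frame_linear_sum:
  assumes "parseval_frame C" "linear h"
  shows "h v = (\<Sum>c\<in>C. (v \<bullet> c) *\<^sub>R h c)"
proof -
  have "(\<Sum>c\<in>C. (v \<bullet> c) *\<^sub>R c) = v" using assms(1) by (simp add: parseval_frame_def)
  from arg_cong[OF this, of h] show ?thesis
    by (simp only: linear_sum[OF assms(2)] linear_scale[OF assms(2)])
qed

text \<open>
  Expanding the inner derivative along the frame, the chain rule reads
  \<open>D(g \<circ> f)(x) v = \<Sum>c. (Df(x) v \<bullet> c) Dg(f x) c\<close>. For fixed \<open>v\<close> this involves only derivatives in fixed
  directions, to which the induction hypothesis applies.
\<close>

lemma Ck_on_compose:
  fixes f :: "'a::real_normed_vector \<Rightarrow> 'b::real_inner" and g :: "'b \<Rightarrow> 'c::real_normed_vector"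
    and C :: "'b set"
  assumes "parseval_frame C" "open S" "open T" "f ` S \<subseteq> T" "Ck_on k T g" "Ck_on k S f"
  shows "Ck_on k S (\<lambda>x. g (f x))"
  using assms(5,6)
proof (induction k arbitrary: g)
  case 0
  then show ?case using assms(4) by (auto intro: continuous_on_compose2)
next
  case (Suc k)
  show ?case
  proof (rule Ck_on_SucI[OF assms(2)])
    fix x assume x: "x \<in> S"
    let ?Df = "frechet_derivative f (at x)" and ?Dg = "frechet_derivative g (at (f x))"
    have df: "(f has_derivative ?Df) (at x)"
      using Ck_on_Suc_has_derivative Suc.prems x by blast
    have dg: "(g has_derivative ?Dg) (at (f x))"
      using Ck_on_Suc_has_derivative Suc.prems x assms(4) by blast
    have lin: "linear ?Dg" using dg has_derivative_linear by blast
    have "?Dg (?Df v) = (\<Sum>c\<in>C. (?Df v \<bullet> c) *\<^sub>R ?Dg c)" for v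
      by (rule parseval_frame_linear_sum[OF assms(1) lin])
    then show "((\<lambda>x. g (f x)) has_derivative (\<lambda>v. \<Sum>c\<in>C. (?Df v \<bullet> c) *\<^sub>R ?Dg c)) (at x)"
      using has_derivative_compose[OF df dg] by simp
  next
    fix v
    show "Ck_on k S (\<lambda>x. \<Sum>c\<in>C. (frechet_derivative f (at x) v \<bullet> c) *\<^sub>R frechet_derivative g (at (f x)) c)"
    proof (intro Ck_on_sum Ck_on_scaleR assms(2))
      fix c
      show "Ck_on k S (\<lambda>x. frechet_derivative f (at x) v \<bullet> c)"
        using Suc.prems(2) by (intro Ck_on_bounded_linear_comp[OF assms(2) bounded_linear_inner_left]) auto
      show "Ck_on k S (\<lambda>x. frechet_derivative g (at (f x)) c)"
        using Suc.IH[of "\<lambda>y. frechet_derivative g (at y) c"] Suc.prems Ck_on_Suc_imp[OF Suc.prems(2)]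
        by simp
    qed
  qed
qed

lemma parseval_frame_Times:
  assumes "parseval_frame B" "parseval_frame C"
  shows "parseval_frame ((\<lambda>b. (b, 0)) ` B \<union> Pair 0 ` C)" (is "parseval_frame (?B \<union> ?C)")
proof -
  have fin: "finite B" "finite C" and fr: "\<And>x. (\<Sum>b\<in>B. (x \<bullet> b) *\<^sub>R b) = x" "\<And>y. (\<Sum>c\<in>C. (y \<bullet> c) *\<^sub>R c) = y"
    using assms by (auto simp: parseval_frame_def)
  have "(\<Sum>p\<in>?B \<union> ?C. ((x, y) \<bullet> p) *\<^sub>R p) = (x, y)" for x y
  proof -
    have "(\<Sum>p\<in>?B \<union> ?C. ((x, y) \<bullet> p) *\<^sub>R p) = (\<Sum>p\<in>?B. ((x, y) \<bullet> p) *\<^sub>R p) + (\<Sum>p\<in>?C. ((x, y) \<bullet> p) *\<^sub>R p)"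
      using fin sum.union_inter[of ?B ?C "\<lambda>p. ((x, y) \<bullet> p) *\<^sub>R p"]
      by (subst sum.union_inter_neutral) auto
    also have "(\<Sum>p\<in>?B. ((x, y) \<bullet> p) *\<^sub>R p) = (\<Sum>b\<in>B. ((x \<bullet> b) *\<^sub>R b, 0))"
      by (subst sum.reindex) (auto simp: inj_on_def)
    also have "(\<Sum>p\<in>?C. ((x, y) \<bullet> p) *\<^sub>R p) = (\<Sum>c\<in>C. (0, (y \<bullet> c) *\<^sub>R c))"
      by (subst sum.reindex) (auto simp: inj_on_def)
    also have "(\<Sum>b\<in>B. ((x \<bullet> b) *\<^sub>R b, 0)) + (\<Sum>c\<in>C. (0, (y \<bullet> c) *\<^sub>R c)) = (x, y)"
      by (simp add: prod_eq_iff fst_sum snd_sum fr)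
    finally show ?thesis .
  qed
  then show ?thesis using fin by (auto simp: parseval_frame_def)
qed

text \<open>
  Gram-Schmidt. The operator \<open>P\<close> that expands along the frame of the span so far is self-adjoint and the
  identity on that span, so \<open>b - P b\<close> is orthogonal to it.
\<close>

lemma ex_parseval_frame_on_span:
  fixes B :: "'b::real_inner set"
  assumes "finite B"
  shows "\<exists>C. finite C \<and> C \<subseteq> span B \<and> (\<forall>x\<in>span B. (\<Sum>c\<in>C. (x \<bullet> c) *\<^sub>R c) = x)"
  using assms
proof (induction B)
  case empty
  then show ?case by (intro exI[of _ "{}"]) auto
next
  case (insert b B)
  then obtain C where fin: "finite C" and sub: "C \<subseteq> span B"
    and fr: "\<And>x. x \<in> span B \<Longrightarrow> (\<Sum>c\<in>C. (x \<bullet> c) *\<^sub>R c) = x" by auto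
  define P where "P x = (\<Sum>c\<in>C. (x \<bullet> c) *\<^sub>R c)" for x
  have P_span: "P x \<in> span B" for x
    unfolding P_def using sub by (intro span_sum span_scale) auto
  have P_self_adjoint: "P x \<bullet> y = x \<bullet> P y" for x y
    by (simp add: P_def inner_sum_left inner_sum_right mult.commute inner_commute[of y])
  have P_id: "P x = x" if "x \<in> span B" for x using fr[OF that] by (simp add: P_def)
  define e where "e = b - P b"
  have e_orth: "e \<bullet> y = 0" if "y \<in> span B" for y
    using P_self_adjoint[of b y] P_id[OF that] by (simp add: e_def inner_diff_left)
  have split: "\<exists>t. x - t *\<^sub>R e \<in> span B" if x: "x \<in> span (insert b B)" for x
  proof -
    obtain t where "x - t *\<^sub>R b \<in> span B"
      using x unfolding span_insert by blast
    then have "(x - t *\<^sub>R b) + t *\<^sub>R P b \<in> span B"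
      using P_span by (intro span_add span_scale)
    then show ?thesis
      by (intro exI[of _ t]) (simp add: e_def algebra_simps)
  qed
  have mono: "span B \<subseteq> span (insert b B)" by (rule span_mono) auto
  show ?case
  proof (cases "e = 0")
    case True
    then show ?thesis
      using fin sub fr mono split by (intro exI[of _ C]) fastforce
  next
    case False
    define n where "n = (1 / norm e) *\<^sub>R e"
    have nn: "n \<bullet> n = 1" using False by (simp add: n_def dot_square_norm power2_eq_square)
    have n_orth: "n \<bullet> y = 0" if "y \<in> span B" for y using e_orth[OF that] by (simp add: n_def)
    have "n \<notin> C" using n_orth nn sub by force
    have "P b \<in> span (insert b B)" using P_span mono by blast
    then have "e \<in> span (insert b B)"
      unfolding e_def by (rule span_diff[OF span_base[OF insertI1]])
    then have nspan: "n \<in> span (insert b B)" unfolding n_def by (rule span_scale)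
    have "(\<Sum>c\<in>insert n C. (x \<bullet> c) *\<^sub>R c) = x" if x: "x \<in> span (insert b B)" for x
    proof -
      obtain t where t: "x - t *\<^sub>R e \<in> span B" using split[OF x] by blast
      define s where "s = t * norm e"
      define y where "y = x - s *\<^sub>R n"
      have y: "y \<in> span B" using t False by (simp add: y_def s_def n_def)
      have xy: "x = s *\<^sub>R n + y" by (simp add: y_def)
      have "x \<bullet> n = s" using n_orth[OF y] nn by (simp add: xy inner_add_left inner_commute[of y])
      moreover have "x \<bullet> c = y \<bullet> c" if "c \<in> C" for c
        using n_orth[of c] that sub by (auto simp: xy inner_add_left)
      then have "(\<Sum>c\<in>C. (x \<bullet> c) *\<^sub>R c) = y" using fr[OF y] by simp
      ultimately show ?thesis using fin \<open>n \<notin> C\<close> by (simp add: y_def)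
    qed
    then show ?thesis
      using fin sub mono nspan by (intro exI[of _ "insert n C"]) blast
  qed
qed

lemma ex_parseval_frame:
  assumes "\<exists>B :: 'b::real_inner set. finite B \<and> span B = UNIV"
  shows "\<exists>C :: 'b set. parseval_frame C"
proof -
  obtain B :: "'b set" where B: "finite B" "span B = UNIV" using assms by blast
  show ?thesis
    using ex_parseval_frame_on_span[OF B(1)] unfolding B(2) parseval_frame_def by blast
qed

text \<open>
  Continuous directional derivatives give a total derivative: by the mean value theorem along the
  segment, the remainder at \<open>x + w\<close> is \<open>(D z - D x) w\<close> for a point \<open>z\<close> of the segment, and finitely many
  directions control \<open>D z - D x\<close> uniformly in \<open>w\<close>.
\<close>

lemma has_derivative_from_directional:
  fixes f :: "'b::real_inner \<Rightarrow> real" and C :: "'b set"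
  assumes C: "parseval_frame C" and S: "open S" "x \<in> S"
    and dir: "\<And>y v. y \<in> S \<Longrightarrow> ((\<lambda>s. f (y + s *\<^sub>R v)) has_real_derivative D y v) (at 0)"
    and lin: "\<And>y. y \<in> S \<Longrightarrow> linear (D y)"
    and cont: "\<And>v. continuous_on S (\<lambda>y. D y v)"
  shows "(f has_derivative D x) (at x)"
proof -
  have finC: "finite C" using C by (simp add: parseval_frame_def)
  obtain r where r: "r > 0" "ball x r \<subseteq> S" using S openE by blast
  \<comment> \<open>\<open>norm w * E y\<close> bounds the change of \<open>D\<close> between \<open>x\<close> and \<open>y\<close> in every direction \<open>w\<close>.\<close>
  define E where "E y = (\<Sum>c\<in>C. norm c * \<bar>D y c - D x c\<bar>)" for y
  have E_bound: "\<bar>D y w - D x w\<bar> \<le> norm w * E y" if "y \<in> S" for y w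
  proof -
    have "D y w - D x w = (\<Sum>c\<in>C. (w \<bullet> c) * (D y c - D x c))"
      unfolding parseval_frame_linear_sum[OF C lin[OF that], of w]
        parseval_frame_linear_sum[OF C lin[OF S(2)], of w]
      by (simp add: sum_subtractf algebra_simps)
    also have "\<bar>\<dots>\<bar> \<le> (\<Sum>c\<in>C. \<bar>(w \<bullet> c) * (D y c - D x c)\<bar>)" by (rule sum_abs)
    also have "\<dots> \<le> (\<Sum>c\<in>C. norm w * (norm c * \<bar>D y c - D x c\<bar>))"
    proof (rule sum_mono)
      fix c
      have "\<bar>w \<bullet> c\<bar> * \<bar>D y c - D x c\<bar> \<le> (norm w * norm c) * \<bar>D y c - D x c\<bar>"
        by (intro mult_right_mono Cauchy_Schwarz_ineq2) auto
      then show "\<bar>(w \<bullet> c) * (D y c - D x c)\<bar> \<le> norm w * (norm c * \<bar>D y c - D x c\<bar>)"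
        by (simp add: abs_mult mult.assoc)
    qed
    finally show ?thesis by (simp add: E_def sum_distrib_left)
  qed
  have "continuous_on S E" unfolding E_def by (intro continuous_intros cont)
  then have "isCont E x" using S continuous_on_eq_continuous_at by blast
  moreover have "E x = 0" by (simp add: E_def)
  ultimately have E0: "(E \<longlongrightarrow> 0) (at x)" by (simp add: isCont_def)
  have remainder: "\<exists>z. norm (z - x) \<le> norm w \<and> \<bar>f (x + w) - f x - D x w\<bar> \<le> norm w * E z"
    if w: "norm w < r" for w
  proof -
    have inS: "x + s *\<^sub>R w \<in> S" if "0 \<le> s" "s \<le> 1" for s
    proof -
      have "norm (s *\<^sub>R w) \<le> norm w" using that by (simp add: mult_left_le_one_le)
      then have "x + s *\<^sub>R w \<in> ball x r" using w by (simp add: dist_norm)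
      then show ?thesis using r by blast
    qed
    have der: "((\<lambda>s. f (x + s *\<^sub>R w)) has_real_derivative D (x + s *\<^sub>R w) w) (at s)"
      if s: "0 \<le> s" "s \<le> 1" for s
    proof -
      have "((\<lambda>h. f (x + s *\<^sub>R w + h *\<^sub>R w)) has_real_derivative D (x + s *\<^sub>R w) w) (at 0)"
        by (rule dir[OF inS[OF s]])
      then have "((\<lambda>h. f (x + (h + s) *\<^sub>R w)) has_real_derivative D (x + s *\<^sub>R w) w) (at 0)"
        by (simp add: algebra_simps)
      then show ?thesis
        using DERIV_shift[of "\<lambda>h. f (x + h *\<^sub>R w)" _ 0 s] by simp
    qed
    obtain \<theta> where \<theta>: "0 < \<theta>" "\<theta> < 1"
      "f (x + 1 *\<^sub>R w) - f (x + 0 *\<^sub>R w) = (1 - 0) * D (x + \<theta> *\<^sub>R w) w"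
      using MVT2[of 0 1 "\<lambda>s. f (x + s *\<^sub>R w)" "\<lambda>s. D (x + s *\<^sub>R w) w"] der by auto
    have "norm (\<theta> *\<^sub>R w) \<le> norm w" using \<theta> by (simp add: mult_left_le_one_le)
    moreover have "\<bar>f (x + w) - f x - D x w\<bar> \<le> norm w * E (x + \<theta> *\<^sub>R w)"
      using \<theta> E_bound[OF inS[of \<theta>], of w] by simp
    ultimately show ?thesis by (intro exI[of _ "x + \<theta> *\<^sub>R w"]) simp
  qed
  show ?thesis
    unfolding has_derivative_at'
  proof (intro conjI allI impI)
    have "bounded_linear (\<lambda>v. \<Sum>c\<in>C. (v \<bullet> c) *\<^sub>R D x c)"
      by (intro bounded_linear_sum bounded_linear_scaleR_const bounded_linear_inner_left)
    then show "bounded_linear (D x)"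
      using parseval_frame_linear_sum[OF C lin[OF S(2)]] by (metis (no_types, lifting) ext)
    fix e :: real assume "e > 0"
    then obtain d where d: "d > 0" "\<And>z. z \<noteq> x \<Longrightarrow> norm (z - x) < d \<Longrightarrow> \<bar>E z\<bar> < e"
      using LIM_D[OF E0 \<open>e > 0\<close>] by auto
    have d': "\<bar>E z\<bar> < e" if "norm (z - x) < d" for z
      using d(2)[of z] that \<open>e > 0\<close> \<open>E x = 0\<close> by (cases "z = x") auto
    show "\<exists>d>0. \<forall>y. 0 < norm (y - x) \<and> norm (y - x) < d \<longrightarrow>
        norm (f y - f x - D x (y - x)) / norm (y - x) < e"
    proof (intro exI[of _ "min d r"] conjI allI impI)
      show "min d r > 0" using d r by simp
      fix y assume y: "0 < norm (y - x) \<and> norm (y - x) < min d r"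
      then obtain z where z: "norm (z - x) \<le> norm (y - x)"
        "\<bar>f (x + (y - x)) - f x - D x (y - x)\<bar> \<le> norm (y - x) * E z"
        using remainder[of "y - x"] by auto
      have "E z < e" using d'[of z] z y by auto
      then have "norm (y - x) * E z < norm (y - x) * e" using y by (intro mult_strict_left_mono) auto
      then have "norm (f y - f x - D x (y - x)) < norm (y - x) * e" using z by simp
      then show "norm (f y - f x - D x (y - x)) / norm (y - x) < e"
        using y by (simp add: pos_divide_less_eq mult.commute)
    qed
  qed
qed

section \<open>Hadamard's lemma\<close>

text \<open>
  These means occur as coefficients in the expansion of \<open>f\<close> around \<open>p\<close>. The weight \<open>t ^ m\<close> makes the
  family closed under differentiation: each derivative produces one more factor \<open>t\<close>.
\<close>

definition radial_mean :: "nat \<Rightarrow> 'b::real_inner \<Rightarrow> ('b \<Rightarrow> real) \<Rightarrow> 'b \<Rightarrow> real" where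
  "radial_mean m p f x = integral (cbox 0 1) (\<lambda>t. t ^ m * f (p + t *\<^sub>R (x - p)))"

lemma radial_segment_in_ball:
  fixes p :: "'b::real_inner"
  assumes "x \<in> ball p r" "t \<in> cbox 0 (1::real)"
  shows "p + t *\<^sub>R (x - p) \<in> ball p r"
proof -
  have "norm (t *\<^sub>R (x - p)) \<le> norm (x - p)" using assms by (simp add: mult_left_le_one_le)
  then show ?thesis using assms by (simp add: dist_norm norm_minus_commute)
qed

lemma continuous_on_radial_integrand:
  fixes p :: "'b::real_inner" and f :: "'b \<Rightarrow> real" and g :: "'c::topological_space \<Rightarrow> 'b"
  assumes "continuous_on (ball p r) f" "continuous_on S g" "g ` S \<subseteq> ball p r"
  shows "continuous_on (S \<times> cbox 0 1) (\<lambda>(s, t). t ^ m * f (p + t *\<^sub>R (g s - p)))"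
proof -
  have g: "continuous_on (S \<times> cbox 0 (1::real)) (\<lambda>z. g (fst z))"
    by (rule continuous_on_compose2[OF assms(2) continuous_on_fst]) (auto intro: continuous_on_id)
  have "continuous_on (S \<times> cbox 0 (1::real)) (\<lambda>z. p + snd z *\<^sub>R (g (fst z) - p))"
    by (intro continuous_intros g)
  moreover have "(\<lambda>z. p + snd z *\<^sub>R (g (fst z) - p)) ` (S \<times> cbox 0 (1::real)) \<subseteq> ball p r"
  proof (rule image_subsetI)
    fix z :: "'c \<times> real" assume z: "z \<in> S \<times> cbox 0 1"
    then have "g (fst z) \<in> ball p r" using assms(3) by auto
    then show "p + snd z *\<^sub>R (g (fst z) - p) \<in> ball p r"
      by (rule radial_segment_in_ball) (use z in auto)
  qed
  ultimately have "continuous_on (S \<times> cbox 0 (1::real)) (\<lambda>z. f (p + snd z *\<^sub>R (g (fst z) - p)))"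
    by (rule continuous_on_compose2[OF assms(1)])
  then show ?thesis
    unfolding split_beta by (intro continuous_intros)
qed

lemma continuous_on_radial_integrand_slice:
  fixes p :: "'b::real_inner" and f :: "'b \<Rightarrow> real"
  assumes "continuous_on (ball p r) f" "x \<in> ball p r"
  shows "continuous_on (cbox 0 1) (\<lambda>t. t ^ m * f (p + t *\<^sub>R (x - p)))"
proof -
  have "continuous_on (cbox 0 (1::real)) (\<lambda>t. f (p + t *\<^sub>R (x - p)))"
    using radial_segment_in_ball[OF assms(2)]
    by (intro continuous_on_compose2[OF assms(1)] continuous_intros) blast
  then show ?thesis by (intro continuous_intros)
qed

lemma continuous_on_radial_mean:
  assumes "continuous_on (ball p r) f"
  shows "continuous_on (ball p r) (radial_mean m p f)"
  unfolding radial_mean_def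
  using continuous_on_radial_integrand[OF assms continuous_on_id]
  by (intro integral_continuous_on_param) auto

text \<open>
  Differentiation under the integral sign is done along one line at a time, where the parameter is
  real; the directional derivatives obtained are again radial means, hence continuous.
\<close>

lemma has_derivative_radial_mean:
  fixes f :: "'b::real_inner \<Rightarrow> real" and C :: "'b set"
  assumes C: "parseval_frame C" and f: "Ck_on (Suc k) (ball p r) f" and x: "x \<in> ball p r"
  shows "(radial_mean m p f has_derivative
      (\<lambda>v. radial_mean (Suc m) p (\<lambda>z. frechet_derivative f (at z) v) x)) (at x)"
proof -
  define D where "D z = frechet_derivative f (at z)" for z
  have D: "(f has_derivative D z) (at z)" if "z \<in> ball p r" for z
    unfolding D_def using f that by (rule Ck_on_Suc_has_derivative)
  have contD: "continuous_on (ball p r) (\<lambda>z. D z v)" for v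
  proof -
    have "Ck_on k (ball p r) (\<lambda>z. D z v)" using f by (simp add: D_def)
    then show ?thesis by (rule Ck_on_imp_continuous_on)
  qed
  have contf: "continuous_on (ball p r) f" using f by (rule Ck_on_imp_continuous_on)
  have "(radial_mean m p f has_derivative (\<lambda>v. radial_mean (Suc m) p (\<lambda>z. D z v) x)) (at x)"
  proof (rule has_derivative_from_directional[OF C open_ball x])
    show "continuous_on (ball p r) (\<lambda>y. radial_mean (Suc m) p (\<lambda>z. D z v) y)" for v
      by (intro continuous_on_radial_mean contD)
  next
    fix y assume y: "y \<in> ball p r"
    have int: "(\<lambda>t. t ^ Suc m * D (p + t *\<^sub>R (y - p)) v) integrable_on cbox 0 1" for v
      by (intro integrable_continuous continuous_on_radial_integrand_slice[OF contD y])
    have linD: "linear (D (p + t *\<^sub>R (y - p)))" if "t \<in> cbox 0 1" for t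
      using D[OF radial_segment_in_ball[OF y that]] has_derivative_linear by blast
    show "linear (\<lambda>v. radial_mean (Suc m) p (\<lambda>z. D z v) y)"
    proof (rule linearI)
      fix v w
      have "radial_mean (Suc m) p (\<lambda>z. D z (v + w)) y = integral (cbox 0 1)
          (\<lambda>t. t ^ Suc m * D (p + t *\<^sub>R (y - p)) v + t ^ Suc m * D (p + t *\<^sub>R (y - p)) w)"
        unfolding radial_mean_def
        by (rule integral_cong) (simp only: linear_add[OF linD] distrib_left)
      also have "\<dots> = radial_mean (Suc m) p (\<lambda>z. D z v) y + radial_mean (Suc m) p (\<lambda>z. D z w) y"
        unfolding radial_mean_def by (rule integral_add[OF int int])
      finally show "radial_mean (Suc m) p (\<lambda>z. D z (v + w)) y =
        radial_mean (Suc m) p (\<lambda>z. D z v) y + radial_mean (Suc m) p (\<lambda>z. D z w) y" .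
    next
      fix s :: real and v
      have "radial_mean (Suc m) p (\<lambda>z. D z (s *\<^sub>R v)) y = integral (cbox 0 1)
          (\<lambda>t. s * (t ^ Suc m * D (p + t *\<^sub>R (y - p)) v))"
        unfolding radial_mean_def
        by (rule integral_cong) (simp only: linear_scale[OF linD] real_scaleR_def mult.left_commute)
      also have "\<dots> = s *\<^sub>R radial_mean (Suc m) p (\<lambda>z. D z v) y"
        unfolding radial_mean_def by simp
      finally show "radial_mean (Suc m) p (\<lambda>z. D z (s *\<^sub>R v)) y =
        s *\<^sub>R radial_mean (Suc m) p (\<lambda>z. D z v) y" .
    qed
    fix v
    \<comment> \<open>Differentiation under the integral is relative to a convex parameter set; as \<open>U\<close> is also open, this is a derivative at 0.\<close>
    define U where "U = {s::real. y + s *\<^sub>R v \<in> ball p r}"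
    have contg: "continuous_on A (\<lambda>s::real. y + s *\<^sub>R v)" for A by (intro continuous_intros)
    have "open U"
      using open_vimage[OF open_ball contg[of UNIV]] by (simp add: U_def vimage_def)
    have "convex U"
    proof (rule convexI)
      fix a b u w :: real
      assume h: "a \<in> U" "b \<in> U" "0 \<le> u" "0 \<le> w" "u + w = 1"
      have "u *\<^sub>R (y + a *\<^sub>R v) + w *\<^sub>R (y + b *\<^sub>R v) = (u + w) *\<^sub>R y + (u * a + w * b) *\<^sub>R v"
        by (simp add: algebra_simps)
      then show "u *\<^sub>R a + w *\<^sub>R b \<in> U"
        using convexD[OF convex_ball[of p r], of "y + a *\<^sub>R v" "y + b *\<^sub>R v" u w] h by (simp add: U_def)
    qed
    have "0 \<in> U" using y by (simp add: U_def)
    have inb: "y + s *\<^sub>R v \<in> ball p r" if "s \<in> U" for s using that by (simp add: U_def)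
    have "((\<lambda>s. integral (cbox 0 1) (\<lambda>t. t ^ m * f (p + t *\<^sub>R ((y + s *\<^sub>R v) - p)))) has_field_derivative
        integral (cbox 0 1) (\<lambda>t. t ^ Suc m * D (p + t *\<^sub>R ((y + 0 *\<^sub>R v) - p)) v)) (at 0 within U)"
    proof (rule leibniz_rule_field_derivative[OF _ _ _ \<open>0 \<in> U\<close> \<open>convex U\<close>])
      fix s t :: real assume s: "s \<in> U" and t: "t \<in> cbox 0 1"
      let ?z = "p + t *\<^sub>R ((y + s *\<^sub>R v) - p)"
      have Dz: "(f has_derivative D ?z) (at ?z)"
        by (intro D radial_segment_in_ball inb s t)
      have "((\<lambda>s. p + t *\<^sub>R ((y + s *\<^sub>R v) - p)) has_derivative (\<lambda>h. t *\<^sub>R (h *\<^sub>R v))) (at s)"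
        by (auto intro!: derivative_eq_intros)
      from has_derivative_compose[OF this Dz]
      have "((\<lambda>s. f (p + t *\<^sub>R ((y + s *\<^sub>R v) - p))) has_derivative (\<lambda>h. D ?z (t *\<^sub>R (h *\<^sub>R v)))) (at s)" .
      moreover have "D ?z (t *\<^sub>R (h *\<^sub>R v)) = (t * D ?z v) * h" for h
        using has_derivative_linear[OF Dz] by (simp add: linear_scale)
      ultimately have "((\<lambda>s. f (p + t *\<^sub>R ((y + s *\<^sub>R v) - p))) has_field_derivative t * D ?z v) (at s)"
        by (simp add: has_field_derivative_def)
      from DERIV_cmult[OF this, of "t ^ m"]
      show "((\<lambda>s. t ^ m * f (p + t *\<^sub>R ((y + s *\<^sub>R v) - p))) has_field_derivative
          t ^ Suc m * D ?z v) (at s within U)"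
        by (simp add: algebra_simps has_field_derivative_at_within)
    next
      fix s assume "s \<in> U"
      show "(\<lambda>t. t ^ m * f (p + t *\<^sub>R ((y + s *\<^sub>R v) - p))) integrable_on cbox 0 1"
        by (intro integrable_continuous continuous_on_radial_integrand_slice[OF contf] inb \<open>s \<in> U\<close>)
    next
      show "continuous_on (U \<times> cbox 0 1) (\<lambda>(s, t). t ^ Suc m * D (p + t *\<^sub>R ((y + s *\<^sub>R v) - p)) v)"
        by (rule continuous_on_radial_integrand[OF contD contg]) (use inb in auto)
    qed
    then show "((\<lambda>s. radial_mean m p f (y + s *\<^sub>R v)) has_real_derivative
        radial_mean (Suc m) p (\<lambda>z. D z v) y) (at 0)"
      using at_within_open[OF \<open>0 \<in> U\<close> \<open>open U\<close>] by (simp add: radial_mean_def)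
  qed
  then show ?thesis by (simp add: D_def)
qed

lemma Ck_on_radial_mean:
  fixes f :: "'b::real_inner \<Rightarrow> real" and C :: "'b set"
  assumes "parseval_frame C" "Ck_on k (ball p r) f"
  shows "Ck_on k (ball p r) (radial_mean m p f)"
  using assms(2)
proof (induction k arbitrary: f m)
  case 0
  then show ?case by (simp add: continuous_on_radial_mean)
next
  case (Suc k)
  show ?case
  proof (rule Ck_on_SucI[OF open_ball])
    show "(radial_mean m p f has_derivative
        (\<lambda>v. radial_mean (Suc m) p (\<lambda>z. frechet_derivative f (at z) v) x)) (at x)"
      if "x \<in> ball p r" for x
      using assms(1) Suc.prems that by (rule has_derivative_radial_mean)
    show "Ck_on k (ball p r) (\<lambda>x. radial_mean (Suc m) p (\<lambda>z. frechet_derivative f (at z) v) x)" for v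
      using Suc by simp
  qed
qed


lemma smooth_on_imp_Ck_on: "smooth_on S f \<Longrightarrow> Ck_on k S f"
  by (simp add: smooth_on_def)

lemma smooth_on_has_derivative:
  "smooth_on S f \<Longrightarrow> x \<in> S \<Longrightarrow> (f has_derivative frechet_derivative f (at x)) (at x)"
  by (rule Ck_on_Suc_has_derivative[OF smooth_on_imp_Ck_on[of S f "Suc 0"]])

lemma smooth_on_frechet_derivative:
  assumes "smooth_on S f"
  shows "smooth_on S (\<lambda>x. frechet_derivative f (at x) v)"
  unfolding smooth_on_def
proof
  fix k
  show "Ck_on k S (\<lambda>x. frechet_derivative f (at x) v)"
    using smooth_on_imp_Ck_on[OF assms, of "Suc k"] by simp
qed

text \<open>
  The fundamental theorem of calculus on the segment from \<open>p\<close> to \<open>x\<close> gives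
  \<open>f x - f p = \<integral> Df(p + t (x - p)) (x - p) dt\<close> over \<open>0 \<le> t \<le> 1\<close>; expanding \<open>x - p\<close> along the frame
  leaves radial means of partial derivatives as coefficients.
\<close>

lemma hadamard_expansion:
  fixes f :: "'b::real_inner \<Rightarrow> real" and C :: "'b set"
  assumes C: "parseval_frame C" and f: "smooth_on (ball p r) f" and "r > 0"
  obtains g where "\<And>c. smooth_on (ball p r) (g c)"
    and "\<And>x. x \<in> ball p r \<Longrightarrow> f x = f p + (\<Sum>c\<in>C. ((x - p) \<bullet> c) * g c x)"
    and "\<And>c. g c p = frechet_derivative f (at p) c"
proof -
  define D where "D z = frechet_derivative f (at z)" for z
  define g where "g c = radial_mean 0 p (\<lambda>z. D z c)" for c
  have smoothD: "smooth_on (ball p r) (\<lambda>z. D z c)" for c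
    unfolding D_def using f by (rule smooth_on_frechet_derivative)
  have contD: "continuous_on (ball p r) (\<lambda>z. D z c)" for c
    using smooth_on_imp_Ck_on[OF smoothD, of 0] by simp
  have 1: "smooth_on (ball p r) (g c)" for c
    unfolding smooth_on_def g_def using Ck_on_radial_mean[OF C] smooth_on_imp_Ck_on[OF smoothD] by blast
  have 2: "f x = f p + (\<Sum>c\<in>C. ((x - p) \<bullet> c) * g c x)" if x: "x \<in> ball p r" for x
  proof -
    define z where "z t = p + t *\<^sub>R (x - p)" for t
    have z: "z t \<in> ball p r" if "t \<in> cbox 0 1" for t
      unfolding z_def by (rule radial_segment_in_ball[OF x that])
    have D: "(f has_derivative D (z t)) (at (z t))" if "t \<in> cbox 0 1" for t
      unfolding D_def by (rule smooth_on_has_derivative[OF f z[OF that]])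
    have "((\<lambda>t. f (z t)) has_vector_derivative D (z t) (x - p)) (at t within {0..1})"
      if "t \<in> {0..1}" for t
    proof -
      have t: "t \<in> cbox 0 1" using that by simp
      have "(z has_derivative (\<lambda>h. h *\<^sub>R (x - p))) (at t)"
        unfolding z_def by (auto intro!: derivative_eq_intros)
      from has_derivative_compose[OF this D[OF t]]
      have "((\<lambda>t. f (z t)) has_vector_derivative D (z t) (x - p)) (at t)"
        using has_derivative_linear[OF D[OF t]] by (simp add: has_vector_derivative_def linear_scale)
      then show ?thesis by (rule has_vector_derivative_at_within)
    qed
    then have "((\<lambda>t. D (z t) (x - p)) has_integral f (z 1) - f (z 0)) {0..1}"
      by (intro fundamental_theorem_of_calculus) auto
    then have "f x - f p = integral (cbox 0 1) (\<lambda>t. D (z t) (x - p))"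
      by (simp add: z_def integral_unique)
    also have "\<dots> = integral (cbox 0 1) (\<lambda>t. \<Sum>c\<in>C. ((x - p) \<bullet> c) * D (z t) c)"
      by (rule integral_cong)
         (use parseval_frame_linear_sum[OF C has_derivative_linear[OF D], of _ "x - p"] in simp)
    also have "\<dots> = (\<Sum>c\<in>C. integral (cbox 0 1) (\<lambda>t. ((x - p) \<bullet> c) * D (z t) c))"
    proof (rule integral_sum)
      show "finite C" using C by (simp add: parseval_frame_def)
      show "(\<lambda>t. ((x - p) \<bullet> c) * D (z t) c) integrable_on cbox 0 1" for c
        using continuous_on_radial_integrand_slice[OF contD x, of 0]
        by (intro integrable_continuous continuous_on_mult_left) (simp add: z_def)
    qed
    also have "\<dots> = (\<Sum>c\<in>C. ((x - p) \<bullet> c) * g c x)"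
      by (simp add: g_def radial_mean_def z_def)
    finally show ?thesis by simp
  qed
  have 3: "g c p = frechet_derivative f (at p) c" for c
    by (simp add: g_def radial_mean_def D_def)
  from that[OF 1 2 3] show ?thesis by blast
qed

section \<open>Smooth functions on manifolds\<close>

lemma smooth_on_subset: "smooth_on S f \<Longrightarrow> T \<subseteq> S \<Longrightarrow> smooth_on T f"
  unfolding smooth_on_def by (blast intro: Ck_on_subset)

lemma smooth_on_cong:
  "open S \<Longrightarrow> (\<And>x. x \<in> S \<Longrightarrow> f x = g x) \<Longrightarrow> smooth_on S f \<longleftrightarrow> smooth_on S g"
  unfolding smooth_on_def by (simp cong: Ck_on_cong)

lemma smooth_on_locally:
  "(\<And>x. x \<in> S \<Longrightarrow> \<exists>T. open T \<and> x \<in> T \<and> smooth_on T f) \<Longrightarrow> smooth_on S f"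
  unfolding smooth_on_def by (meson Ck_on_locally)

lemma smooth_on_const: "smooth_on S (\<lambda>x. c)"
  by (simp add: smooth_on_def Ck_on_const)

lemma smooth_on_add:
  "open S \<Longrightarrow> smooth_on S f \<Longrightarrow> smooth_on S g \<Longrightarrow> smooth_on S (\<lambda>x. f x + g x)"
  by (simp add: smooth_on_def Ck_on_add)

lemma smooth_on_mult:
  fixes f g :: "'a::real_normed_vector \<Rightarrow> real"
  shows "open S \<Longrightarrow> smooth_on S f \<Longrightarrow> smooth_on S g \<Longrightarrow> smooth_on S (\<lambda>x. f x * g x)"
  using Ck_on_scaleR[of S _ f g] by (simp add: smooth_on_def)

lemma smooth_on_compose:
  fixes C :: "'b::real_inner set"
  assumes "parseval_frame C" "open S" "open T" "f ` S \<subseteq> T" "smooth_on T g" "smooth_on S f"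
  shows "smooth_on S (\<lambda>x. g (f x :: 'b))"
  using assms by (auto simp: smooth_on_def intro: Ck_on_compose)

lemma smooth_on_affine:
  assumes "open S" "bounded_linear h"
  shows "smooth_on S (\<lambda>x. c + h x)"
proof -
  have "Ck_on k S (\<lambda>x. x)" for k
  proof (cases k)
    case (Suc n)
    show ?thesis
      unfolding Suc
      by (rule Ck_on_SucI[OF assms(1), where D = "\<lambda>x v. v"]) (auto intro: Ck_on_const)
  qed (simp add: continuous_on_id)
  then show ?thesis
    unfolding smooth_on_def
    by (intro allI Ck_on_add[OF assms(1)] Ck_on_const Ck_on_bounded_linear_comp[OF assms])
qed

lemma smooth_on_transform:
  "smooth_on S f \<Longrightarrow> open S \<Longrightarrow> (\<And>x. x \<in> S \<Longrightarrow> f x = g x) \<Longrightarrow> smooth_on S g"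
  using smooth_on_cong by blast

text \<open>
  The algebra of smooth functions rests on this part of the manifold axioms alone. It passes to
  products factor by factor, so that functions of two group elements can be treated like functions of one.
\<close>

locale open_atlas =
  fixes M :: "('a, 'e::real_inner) mfd"
  assumes chart_subset: "(U, \<phi>) \<in> atlas M \<Longrightarrow> U \<subseteq> topspace (mtop M)"
    and chart_inj: "(U, \<phi>) \<in> atlas M \<Longrightarrow> inj_on \<phi> U"
    and chart_open_image: "(U, \<phi>) \<in> atlas M \<Longrightarrow> openin (mtop M) W \<Longrightarrow> open (\<phi> ` (U \<inter> W))"

text \<open>
  The condition inside \<open>smooth_near\<close>, for a fixed open set; the gain is that \<open>f\<close> can be studied at all
  points of \<open>W\<close> with the same neighbourhood.
\<close>

definition smooth_fun_on :: "('a, 'e::real_inner) mfd \<Rightarrow> 'a set \<Rightarrow> ('a \<Rightarrow> real) \<Rightarrow> bool" where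
  "smooth_fun_on M W f \<longleftrightarrow>
     (\<forall>U \<phi>. (U, \<phi>) \<in> atlas M \<longrightarrow> smooth_on (\<phi> ` (U \<inter> W)) (\<lambda>z. f (inv_into U \<phi> z)))"

lemma smooth_near_iff:
  "smooth_near M p f \<longleftrightarrow> (\<exists>W. openin (mtop M) W \<and> p \<in> W \<and> smooth_fun_on M W f)"
  by (auto simp: smooth_near_def smooth_fun_on_def o_def)

lemma smooth_fun_onD:
  "smooth_fun_on M W f \<Longrightarrow> (U, \<phi>) \<in> atlas M \<Longrightarrow> smooth_on (\<phi> ` (U \<inter> W)) (\<lambda>z. f (inv_into U \<phi> z))"
  by (simp add: smooth_fun_on_def)

lemma smooth_fun_on_subset: "smooth_fun_on M W f \<Longrightarrow> V \<subseteq> W \<Longrightarrow> smooth_fun_on M V f"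
  unfolding smooth_fun_on_def by (meson Int_mono image_mono smooth_on_subset subset_refl)

context open_atlas
begin

lemma smooth_fun_on_cong:
  assumes "openin (mtop M) W" "\<And>x. x \<in> W \<Longrightarrow> f x = g x"
  shows "smooth_fun_on M W f \<longleftrightarrow> smooth_fun_on M W g"
proof -
  have "smooth_on (\<phi> ` (U \<inter> W)) (\<lambda>z. f (inv_into U \<phi> z)) \<longleftrightarrow>
        smooth_on (\<phi> ` (U \<inter> W)) (\<lambda>z. g (inv_into U \<phi> z))" if "(U, \<phi>) \<in> atlas M" for U \<phi>
    using chart_inj[OF that] by (intro smooth_on_cong chart_open_image that assms(1)) (auto simp: assms(2))
  then show ?thesis by (auto simp: smooth_fun_on_def)
qed

lemma smooth_fun_on_const: "smooth_fun_on M W (\<lambda>x. c)"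
  by (simp add: smooth_fun_on_def smooth_on_const)

lemma smooth_fun_on_add:
  "openin (mtop M) W \<Longrightarrow> smooth_fun_on M W f \<Longrightarrow> smooth_fun_on M W g \<Longrightarrow>
    smooth_fun_on M W (\<lambda>x. f x + g x)"
  unfolding smooth_fun_on_def by (auto intro!: smooth_on_add chart_open_image)

lemma smooth_fun_on_mult:
  "openin (mtop M) W \<Longrightarrow> smooth_fun_on M W f \<Longrightarrow> smooth_fun_on M W g \<Longrightarrow>
    smooth_fun_on M W (\<lambda>x. f x * g x)"
  unfolding smooth_fun_on_def by (auto intro!: smooth_on_mult chart_open_image)

lemma smooth_near_cong:
  assumes "openin (mtop M) W" "p \<in> W" "\<And>x. x \<in> W \<Longrightarrow> f x = g x" "smooth_near M p f"
  shows "smooth_near M p g"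
proof -
  obtain V where V: "openin (mtop M) V" "p \<in> V" "smooth_fun_on M V f"
    using assms(4) by (auto simp: smooth_near_iff)
  have VW: "openin (mtop M) (V \<inter> W)" using V(1) assms(1) by blast
  have "smooth_fun_on M (V \<inter> W) f" using V(3) by (rule smooth_fun_on_subset) auto
  then have "smooth_fun_on M (V \<inter> W) g"
    using smooth_fun_on_cong[OF VW, of f g] assms(3) by auto
  then show ?thesis using VW V(2) assms(2) by (auto simp: smooth_near_iff)
qed

lemma smooth_near_const:
  assumes "p \<in> topspace (mtop M)"
  shows "smooth_near M p (\<lambda>x. c)"
  using assms openin_topspace smooth_fun_on_const smooth_near_iff by metis

lemma smooth_near_add_mult:
  assumes "smooth_near M p f" "smooth_near M p g"
  shows smooth_near_add: "smooth_near M p (\<lambda>x. f x + g x)"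
    and smooth_near_mult: "smooth_near M p (\<lambda>x. f x * g x)"
proof -
  obtain V W where V: "openin (mtop M) V" "p \<in> V" "smooth_fun_on M V f"
    and W: "openin (mtop M) W" "p \<in> W" "smooth_fun_on M W g"
    using assms by (auto simp: smooth_near_iff)
  have VW: "openin (mtop M) (V \<inter> W)" using V(1) W(1) by blast
  have f: "smooth_fun_on M (V \<inter> W) f" using V(3) by (rule smooth_fun_on_subset) auto
  have g: "smooth_fun_on M (V \<inter> W) g" using W(3) by (rule smooth_fun_on_subset) auto
  show "smooth_near M p (\<lambda>x. f x + g x)"
    using smooth_fun_on_add[OF VW f g] VW V(2) W(2) by (auto simp: smooth_near_iff)
  show "smooth_near M p (\<lambda>x. f x * g x)"
    using smooth_fun_on_mult[OF VW f g] VW V(2) W(2) by (auto simp: smooth_near_iff)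
qed

end

lemma smooth_near_topspace: "smooth_near M p f \<Longrightarrow> p \<in> topspace (mtop M)"
  using openin_subset by (fastforce simp: smooth_near_iff)

context smooth_manifold
begin

lemma chart_subset_topspace: "(U, \<phi>) \<in> atlas M \<Longrightarrow> U \<subseteq> topspace (mtop M)"
  using chart_domain_open openin_subset by blast

lemma topspace_chart: "(U, \<phi>) \<in> atlas M \<Longrightarrow> topspace (subtopology (mtop M) U) = U"
  using chart_subset_topspace by auto

sublocale open_atlas M
proof
  fix U \<phi> assume c: "(U, \<phi>) \<in> atlas M"
  show "U \<subseteq> topspace (mtop M)" using c by (rule chart_subset_topspace)
  show "inj_on \<phi> U"
    using homeomorphic_imp_injective_map[OF chart_homeomorphism[OF c]] topspace_chart[OF c] by simp
  fix W assume "openin (mtop M) W"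
  then have "openin (subtopology (mtop M) U) (U \<inter> W)"
    by (auto simp: openin_subtopology)
  then have "openin (top_of_set (\<phi> ` U)) (\<phi> ` (U \<inter> W))"
    using homeomorphic_imp_open_map[OF chart_homeomorphism[OF c]] by (simp add: open_map_def)
  then show "open (\<phi> ` (U \<inter> W))"
    using chart_image_open[OF c] openin_open_trans by blast
qed

lemma chart_preimage_open:
  assumes c: "(U, \<phi>) \<in> atlas M" and "open S"
  shows "openin (mtop M) {x \<in> U. \<phi> x \<in> S}"
proof -
  have "continuous_map (subtopology (mtop M) U) euclidean \<phi>"
    using homeomorphic_imp_continuous_map[OF chart_homeomorphism[OF c]]
    by (simp add: continuous_map_in_subtopology)
  then have "openin (subtopology (mtop M) U) {x \<in> topspace (subtopology (mtop M) U). \<phi> x \<in> S}"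
    by (rule openin_continuous_map_preimage) (use assms(2) in simp)
  then show ?thesis
    unfolding topspace_chart[OF c] using chart_domain_open[OF c] by (rule openin_trans_full)
qed

lemma chart_at:
  assumes "p \<in> topspace (mtop M)"
  obtains U \<phi> where "(U, \<phi>) \<in> atlas M" "p \<in> U"
  using assms charts_cover by blast

text \<open>
  Smoothness in the single chart \<open>\<phi>\<close> suffices: in any other chart the function is read through a
  smooth transition map.
\<close>

lemma smooth_fun_on_chart_comp:
  assumes c: "(U, \<phi>) \<in> atlas M" and W: "openin (mtop M) W" "W \<subseteq> U"
    and S: "open S" "\<phi> ` W \<subseteq> S" "smooth_on S g"
  shows "smooth_fun_on M W (\<lambda>x. g (\<phi> x))"
  unfolding smooth_fun_on_def
proof (intro allI impI)
  fix V \<psi> assume d: "(V, \<psi>) \<in> atlas M"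
  obtain C :: "'e set" where C: "parseval_frame C"
    using ex_parseval_frame[OF finite_dimensional] by blast
  have inj: "inv_into V \<psi> (\<psi> x) = x" if "x \<in> V" for x
    using chart_inj[OF d] that by simp
  have "smooth_on (\<psi> ` (V \<inter> W)) (\<lambda>z. \<phi> (inv_into V \<psi> z))"
    using transition_smooth[OF d c] unfolding o_def by (rule smooth_on_subset) (use W in auto)
  then show "smooth_on (\<psi> ` (V \<inter> W)) (\<lambda>z. g (\<phi> (inv_into V \<psi> z)))"
    by (intro smooth_on_compose[OF C _ S(1) _ S(3)] chart_open_image d W(1)) (use inj S(2) in auto)
qed

end

text \<open>
  Near each point, the local expression of \<open>f \<circ> F\<close> factors through a chart of \<open>N\<close> around the image
  point into local expressions of \<open>f\<close> and \<open>F\<close>.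
\<close>

lemma (in open_atlas) smooth_fun_on_comp:
  fixes N :: "('b, 'f::real_inner) mfd"
  assumes N: "smooth_manifold N" and F: "smooth_map M N F"
    and W: "openin (mtop N) W" and f: "smooth_fun_on N W f"
  shows "openin (mtop M) {x \<in> topspace (mtop M). F x \<in> W}"
    and "smooth_fun_on M {x \<in> topspace (mtop M). F x \<in> W} (\<lambda>x. f (F x))"
proof -
  interpret N: smooth_manifold N by fact
  obtain C :: "'f set" where C: "parseval_frame C"
    using ex_parseval_frame[OF N.finite_dimensional] by blast
  have contF: "continuous_map (mtop M) (mtop N) F" using F by (simp add: smooth_map_def)
  have pre: "openin (mtop M) {x \<in> topspace (mtop M). F x \<in> V}" if "openin (mtop N) V" for V
    using contF that by (rule openin_continuous_map_preimage)
  show "openin (mtop M) {x \<in> topspace (mtop M). F x \<in> W}" using pre[OF W] .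
  show "smooth_fun_on M {x \<in> topspace (mtop M). F x \<in> W} (\<lambda>x. f (F x))"
    unfolding smooth_fun_on_def
  proof (intro allI impI smooth_on_locally)
    fix U \<phi> z assume c: "(U, \<phi>) \<in> atlas M"
      and "z \<in> \<phi> ` (U \<inter> {x \<in> topspace (mtop M). F x \<in> W})"
    then obtain x where x: "x \<in> U" "x \<in> topspace (mtop M)" "F x \<in> W" "z = \<phi> x" by blast
    have inj: "inv_into U \<phi> (\<phi> y) = y" if "y \<in> U" for y
      using chart_inj[OF c] that by simp
    obtain V \<psi> where d: "(V, \<psi>) \<in> atlas N" "F x \<in> V"
      using N.chart_at W x(3) openin_subset by blast
    have injV: "inv_into V \<psi> (\<psi> y) = y" if "y \<in> V" for y
      using N.chart_inj[OF d(1)] that by simp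
    define T where "T = \<phi> ` (U \<inter> {x \<in> topspace (mtop M). F x \<in> V \<inter> W})"
    have "openin (mtop N) (V \<inter> W)" using N.chart_domain_open[OF d(1)] W by blast
    then have openT: "open T" unfolding T_def by (intro chart_open_image[OF c] pre)
    have "smooth_on (\<phi> ` (U \<inter> F -` V)) (\<psi> \<circ> F \<circ> inv_into U \<phi>)"
      using F c d(1) unfolding smooth_map_def by fastforce
    then have FT: "smooth_on T (\<lambda>z. \<psi> (F (inv_into U \<phi> z)))"
      unfolding T_def o_def by (rule smooth_on_subset) auto
    have fF: "smooth_on T (\<lambda>z. f (inv_into V \<psi> (\<psi> (F (inv_into U \<phi> z)))))"
      by (rule smooth_on_compose[OF C openT N.chart_open_image[OF d(1) W] _ smooth_fun_onD[OF f d(1)] FT])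
         (use inj in \<open>auto simp: T_def\<close>)
    have "smooth_on T (\<lambda>z. f (F (inv_into U \<phi> z)))"
      by (rule smooth_on_transform[OF fF openT]) (use inj injV in \<open>auto simp: T_def\<close>)
    moreover have "z \<in> T" using x d(2) by (auto simp: T_def)
    ultimately show "\<exists>T. open T \<and> z \<in> T \<and> smooth_on T (\<lambda>z. f (F (inv_into U \<phi> z)))"
      using openT by blast
  qed
qed

lemma (in open_atlas) smooth_near_comp:
  fixes N :: "('b, 'f::real_inner) mfd"
  assumes N: "smooth_manifold N" and F: "smooth_map M N F"
    and p: "p \<in> topspace (mtop M)" and f: "smooth_near N (F p) f"
  shows "smooth_near M p (\<lambda>x. f (F x))"
proof -
  obtain W where "openin (mtop N) W" "F p \<in> W" "smooth_fun_on N W f"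
    using f by (auto simp: smooth_near_iff)
  then show ?thesis
    unfolding smooth_near_iff using smooth_fun_on_comp[OF N F, of W f] p by blast
qed

lemma open_atlas_prod_mfd:
  fixes M :: "('a, 'e::real_inner) mfd" and N :: "('b, 'f::real_inner) mfd"
  assumes "open_atlas M" "open_atlas N"
  shows "open_atlas (prod_mfd M N)"
proof
  interpret M: open_atlas M by fact
  interpret N: open_atlas N by fact
  fix P :: "('a \<times> 'b) set" and \<kappa> assume "(P, \<kappa>) \<in> atlas (prod_mfd M N)"
  then obtain U \<phi> V \<psi> where c: "(U, \<phi>) \<in> atlas M" "(V, \<psi>) \<in> atlas N"
    and P: "P = U \<times> V" "\<kappa> = map_prod \<phi> \<psi>"
    by (auto simp: prod_mfd_def)
  show "P \<subseteq> topspace (mtop (prod_mfd M N))"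
    using M.chart_subset[OF c(1)] N.chart_subset[OF c(2)] by (auto simp: P prod_mfd_def)
  show "inj_on \<kappa> P"
    unfolding P by (intro map_prod_inj_on M.chart_inj[OF c(1)] N.chart_inj[OF c(2)])
  fix W assume W: "openin (mtop (prod_mfd M N)) W"
  show "open (\<kappa> ` (P \<inter> W))"
  proof (subst open_subopen, intro ballI)
    fix z assume "z \<in> \<kappa> ` (P \<inter> W)"
    then obtain x y where xy: "x \<in> U" "y \<in> V" "(x, y) \<in> W" "z = (\<phi> x, \<psi> y)"
      by (auto simp: P)
    have "openin (prod_topology (mtop M) (mtop N)) W" using W by (simp add: prod_mfd_def)
    then have "\<exists>W1 W2. openin (mtop M) W1 \<and> openin (mtop N) W2 \<and> x \<in> W1 \<and> y \<in> W2 \<and> W1 \<times> W2 \<subseteq> W"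
      using xy(3) unfolding openin_prod_topology_alt by blast
    then obtain W1 W2 where box: "openin (mtop M) W1" "openin (mtop N) W2" "x \<in> W1" "y \<in> W2"
      "W1 \<times> W2 \<subseteq> W" by blast
    have "open (\<phi> ` (U \<inter> W1) \<times> \<psi> ` (V \<inter> W2))"
      by (intro open_Times M.chart_open_image N.chart_open_image c box)
    moreover have "z \<in> \<phi> ` (U \<inter> W1) \<times> \<psi> ` (V \<inter> W2)" using xy box by auto
    moreover have "\<phi> ` (U \<inter> W1) \<times> \<psi> ` (V \<inter> W2) \<subseteq> \<kappa> ` (P \<inter> W)"
      using box(5) by (force simp: P)
    ultimately show "\<exists>T. open T \<and> z \<in> T \<and> T \<subseteq> \<kappa> ` (P \<inter> W)" by blast
  qed
qed

section \<open>Tangent vectors as directional derivatives\<close>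

lemma tangent_spaceD:
  assumes "D \<in> tangent_space M p"
  shows tangent_not_smooth: "\<not> smooth_near M p f \<Longrightarrow> D f = 0"
    and tangent_add: "smooth_near M p f \<Longrightarrow> smooth_near M p g \<Longrightarrow> D (\<lambda>x. f x + g x) = D f + D g"
    and tangent_cmult: "smooth_near M p f \<Longrightarrow> D (\<lambda>x. c * f x) = c * D f"
    and tangent_mult: "smooth_near M p f \<Longrightarrow> smooth_near M p g \<Longrightarrow>
        D (\<lambda>x. f x * g x) = f p * D g + g p * D f"
  using assms by (auto simp: tangent_space_def)

context open_atlas
begin

lemma smooth_near_cmult: "smooth_near M p f \<Longrightarrow> smooth_near M p (\<lambda>x. c * f x)"
  by (rule smooth_near_mult[OF smooth_near_const]) (auto intro: smooth_near_topspace)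

lemma tangent_diff:
  assumes "D \<in> tangent_space M p" "smooth_near M p f" "smooth_near M p g"
  shows "D (\<lambda>x. f x - g x) = D f - D g"
  using tangent_add[OF assms(1,2) smooth_near_cmult[OF assms(3), of "-1"]]
    tangent_cmult[OF assms(1,3), of "-1"] by simp

text \<open>
  Locality: if \<open>h\<close> is the indicator of a neighbourhood on which \<open>f\<close> and \<open>g\<close> agree, then \<open>f h = g h\<close>, and
  the Leibniz rule at \<open>p\<close>, where \<open>h = 1\<close>, compares \<open>D f\<close> with \<open>D g\<close>.
\<close>

lemma tangent_cong:
  assumes D: "D \<in> tangent_space M p"
    and W: "openin (mtop M) W" "p \<in> W" "\<And>x. x \<in> W \<Longrightarrow> f x = g x"
  shows "D f = D g"
proof (cases "smooth_near M p f")
  case True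
  then have g: "smooth_near M p g" using W by (rule smooth_near_cong[rotated -1])
  define h :: "'a \<Rightarrow> real" where "h x = (if x \<in> W then 1 else 0)" for x
  have "p \<in> topspace (mtop M)" using True by (rule smooth_near_topspace)
  then have h: "smooth_near M p h"
    using smooth_near_cong[OF W(1,2), of "\<lambda>x. 1" h] smooth_near_const by (simp add: h_def)
  have "(\<lambda>x. f x * h x) = (\<lambda>x. g x * h x)" using W(3) by (auto simp: h_def)
  then have "f p * D h + h p * D f = g p * D h + h p * D g"
    using tangent_mult[OF D True h] tangent_mult[OF D g h] by simp
  then show ?thesis using W(2,3) by (simp add: h_def)
next
  case False
  then have "\<not> smooth_near M p g"
    using smooth_near_cong[OF W(1,2), of g f] W(3) by auto
  then show ?thesis using tangent_not_smooth[OF D] False by simp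
qed

lemma tangent_const:
  assumes D: "D \<in> tangent_space M p" and p: "p \<in> topspace (mtop M)"
  shows "D (\<lambda>x. c) = 0"
proof -
  \<comment> \<open>The Leibniz rule for \<open>1 * 1\<close> gives \<open>D 1 = 2 * D 1\<close>.\<close>
  have "D (\<lambda>x. 1) = 0"
    using tangent_mult[OF D smooth_near_const[OF p] smooth_near_const[OF p], of 1 1] by simp
  then show ?thesis
    using tangent_cmult[OF D smooth_near_const[OF p], of c 1] by simp
qed

lemma tangent_sum:
  assumes D: "D \<in> tangent_space M p" and p: "p \<in> topspace (mtop M)"
    and "finite I" "\<And>i. i \<in> I \<Longrightarrow> smooth_near M p (f i)"
  shows "smooth_near M p (\<lambda>x. \<Sum>i\<in>I. f i x) \<and> D (\<lambda>x. \<Sum>i\<in>I. f i x) = (\<Sum>i\<in>I. D (f i))"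
  using assms(3,4)
proof (induction I)
  case empty
  then show ?case using tangent_const[OF D p] smooth_near_const[OF p] by simp
next
  case (insert i I)
  then show ?case
    using tangent_add[OF D, of "f i"] smooth_near_add[of p "f i"] by simp
qed

end

text \<open>
  Apply \<open>D\<close> to the expansion \<open>f = f p + \<Sum>b. coord b * (g b \<circ> \<phi>)\<close> of Hadamard's lemma. The coordinates
  vanish at \<open>p\<close>, so the Leibniz rule leaves \<open>\<Sum>b. D (coord b) * g b (\<phi> p)\<close>, and \<open>g b (\<phi> p)\<close> is a partial
  derivative of \<open>f\<close>.
\<close>

lemma (in smooth_manifold) tangent_eq_directional_derivative:
  assumes D: "D \<in> tangent_space M p" and c: "(U, \<phi>) \<in> atlas M" and p: "p \<in> U"
  obtains \<xi> where "\<And>f. smooth_near M p f \<Longrightarrow>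
    D f = frechet_derivative (\<lambda>z. f (inv_into U \<phi> z)) (at (\<phi> p)) \<xi>"
proof -
  obtain C :: "'e set" where C: "parseval_frame C"
    using ex_parseval_frame[OF finite_dimensional] by blast
  have finC: "finite C" using C by (simp add: parseval_frame_def)
  have pt: "p \<in> topspace (mtop M)" using chart_subset_topspace[OF c] p by blast
  have inj: "inv_into U \<phi> (\<phi> y) = y" if "y \<in> U" for y
    using chart_inj[OF c] that by simp
  define coord where "coord b = (\<lambda>x. (\<phi> x - \<phi> p) \<bullet> b)" for b
  have coord: "smooth_near M p (coord b)" for b
  proof -
    have "smooth_on UNIV (\<lambda>z. - (\<phi> p \<bullet> b) + z \<bullet> b)"
      by (rule smooth_on_affine[OF open_UNIV bounded_linear_inner_left])
    then have "smooth_fun_on M U (\<lambda>x. - (\<phi> p \<bullet> b) + \<phi> x \<bullet> b)"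
      by (rule smooth_fun_on_chart_comp[OF c chart_domain_open[OF c] subset_refl open_UNIV subset_UNIV])
    then show ?thesis
      using chart_domain_open[OF c] p by (auto simp: smooth_near_iff coord_def inner_diff_left)
  qed
  define \<xi> where "\<xi> = (\<Sum>b\<in>C. D (coord b) *\<^sub>R b)"
  have "D f = frechet_derivative (\<lambda>z. f (inv_into U \<phi> z)) (at (\<phi> p)) \<xi>" if f: "smooth_near M p f" for f
  proof -
    obtain W where W: "openin (mtop M) W" "p \<in> W" "smooth_fun_on M W f"
      using f by (auto simp: smooth_near_iff)
    let ?h = "\<lambda>z. f (inv_into U \<phi> z)"
    have h: "smooth_on (\<phi> ` (U \<inter> W)) ?h" using smooth_fun_onD[OF W(3) c] .
    obtain r where r: "r > 0" "ball (\<phi> p) r \<subseteq> \<phi> ` (U \<inter> W)"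
      using openE[OF chart_open_image[OF c W(1)], of "\<phi> p"] W(2) p by blast
    have hb: "smooth_on (ball (\<phi> p) r) ?h" using h r(2) by (rule smooth_on_subset)
    obtain g where g: "\<And>b. smooth_on (ball (\<phi> p) r) (g b)"
      "\<And>z. z \<in> ball (\<phi> p) r \<Longrightarrow> ?h z = ?h (\<phi> p) + (\<Sum>b\<in>C. ((z - \<phi> p) \<bullet> b) * g b z)"
      "\<And>b. g b (\<phi> p) = frechet_derivative ?h (at (\<phi> p)) b"
      using hadamard_expansion[OF C hb r(1)] by blast
    define B where "B = {x \<in> U. \<phi> x \<in> ball (\<phi> p) r}"
    have B: "openin (mtop M) B" "B \<subseteq> U" "\<phi> ` B \<subseteq> ball (\<phi> p) r" "p \<in> B"
      using chart_preimage_open[OF c open_ball, of "\<phi> p" r] r(1) p by (auto simp: B_def)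
    have gs: "smooth_near M p (\<lambda>x. g b (\<phi> x))" for b
      using smooth_fun_on_chart_comp[OF c B(1,2) open_ball B(3) g(1)] B(1,4)
      unfolding smooth_near_iff by blast
    have cg: "smooth_near M p (\<lambda>x. coord b x * g b (\<phi> x))" for b
      by (rule smooth_near_mult[OF coord gs])
    have sum: "smooth_near M p (\<lambda>x. \<Sum>b\<in>C. coord b x * g b (\<phi> x))"
      "D (\<lambda>x. \<Sum>b\<in>C. coord b x * g b (\<phi> x)) = (\<Sum>b\<in>C. D (\<lambda>x. coord b x * g b (\<phi> x)))"
      using tangent_sum[OF D pt finC cg] by auto
    have "f x = f p + (\<Sum>b\<in>C. coord b x * g b (\<phi> x))" if "x \<in> B" for x
      using g(2)[of "\<phi> x"] that inj p by (auto simp: B_def coord_def)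
    then have "D f = D (\<lambda>x. f p + (\<Sum>b\<in>C. coord b x * g b (\<phi> x)))"
      by (rule tangent_cong[OF D B(1,4)])
    also have "\<dots> = (\<Sum>b\<in>C. D (\<lambda>x. coord b x * g b (\<phi> x)))"
      using tangent_add[OF D smooth_near_const[OF pt] sum(1)] sum(2) tangent_const[OF D pt] by simp
    also have "\<dots> = (\<Sum>b\<in>C. D (coord b) * g b (\<phi> p))"
      using tangent_mult[OF D coord gs] by (simp add: coord_def mult.commute)
    also have "\<dots> = frechet_derivative ?h (at (\<phi> p)) \<xi>"
    proof -
      have "linear (frechet_derivative ?h (at (\<phi> p)))"
        by (rule has_derivative_linear[OF smooth_on_has_derivative[OF hb]]) (use r(1) in simp)
      then show ?thesis by (simp add: \<xi>_def g(3) linear_sum linear_scale)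
    qed
    finally show ?thesis .
  qed
  then show ?thesis using that by blast
qed

text \<open>
  In a chart around \<open>q\<close>, \<open>D\<close> differentiates in a fixed direction \<open>\<xi>\<close>. Hence \<open>D (F x)\<close> is the derivative
  of the local expression of \<open>F\<close> in the direction \<open>(0, \<xi>)\<close>, taken at a point that depends smoothly on \<open>x\<close>.
\<close>

lemma
  fixes M :: "('a, 'e::real_inner) mfd" and N :: "('b, 'f::real_inner) mfd"
  assumes M: "smooth_manifold M" and N: "smooth_manifold N"
    and V: "openin (mtop M) V" and W: "openin (mtop N) W"
    and F: "smooth_fun_on (prod_mfd M N) (V \<times> W) (\<lambda>(x, y). F x y)"
  shows smooth_fun_on_slice: "x \<in> V \<Longrightarrow> smooth_fun_on N W (F x)"
    and smooth_fun_on_tangent_slice: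
      "D \<in> tangent_space N q \<Longrightarrow> q \<in> W \<Longrightarrow> smooth_fun_on M V (\<lambda>x. D (F x))"
proof -
  interpret M: smooth_manifold M by fact
  interpret N: smooth_manifold N by fact
  obtain B :: "'e set" and C :: "'f set" where BC: "parseval_frame B" "parseval_frame C"
    using ex_parseval_frame[OF M.finite_dimensional] ex_parseval_frame[OF N.finite_dimensional] by blast
  note frame = parseval_frame_Times[OF BC]
  define H where "H U \<phi> V \<psi> = (\<lambda>p. F (inv_into U \<phi> (fst p)) (inv_into V \<psi> (snd p)))"
    for U :: "'a set" and \<phi> :: "'a \<Rightarrow> 'e" and V :: "'b set" and \<psi> :: "'b \<Rightarrow> 'f"
  have H: "smooth_on (\<phi> ` (U \<inter> V) \<times> \<psi> ` (U' \<inter> W)) (H U \<phi> U' \<psi>)"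
    if c: "(U, \<phi>) \<in> atlas M" "(U', \<psi>) \<in> atlas N" for U \<phi> U' \<psi>
  proof -
    have "(U \<times> U', map_prod \<phi> \<psi>) \<in> atlas (prod_mfd M N)"
      using c by (auto simp: prod_mfd_def)
    then have "smooth_on (map_prod \<phi> \<psi> ` (U \<times> U' \<inter> V \<times> W))
        (\<lambda>p. (\<lambda>(x, y). F x y) (inv_into (U \<times> U') (map_prod \<phi> \<psi>) p))"
      by (rule smooth_fun_onD[OF F])
    moreover have "map_prod \<phi> \<psi> ` (U \<times> U' \<inter> V \<times> W) = \<phi> ` (U \<inter> V) \<times> \<psi> ` (U' \<inter> W)"
      by (simp add: Times_Int_Times map_prod_surj_on)
    moreover have "(\<lambda>(x, y). F x y) (inv_into (U \<times> U') (map_prod \<phi> \<psi>) p) = H U \<phi> U' \<psi> p"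
      if p: "p \<in> \<phi> ` (U \<inter> V) \<times> \<psi> ` (U' \<inter> W)" for p
    proof -
      obtain x y where xy: "x \<in> U" "y \<in> U'" "p = map_prod \<phi> \<psi> (x, y)" using p by auto
      have "inj_on (map_prod \<phi> \<psi>) (U \<times> U')"
        by (intro map_prod_inj_on M.chart_inj[OF c(1)] N.chart_inj[OF c(2)])
      then have "inv_into (U \<times> U') (map_prod \<phi> \<psi>) p = (x, y)"
        unfolding xy(3) using xy by (intro inv_into_f_f) auto
      then show ?thesis
        using xy M.chart_inj[OF c(1)] N.chart_inj[OF c(2)] by (simp add: H_def)
    qed
    ultimately show ?thesis
      by (simp only:) (erule smooth_on_transform, blast intro: open_Times M.chart_open_image[OF c(1) V] N.chart_open_image[OF c(2) W], blast)
  qed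
  have right: "bounded_linear (\<lambda>w::'f. (0::'e, w))" and left: "bounded_linear (\<lambda>z::'e. (z, 0::'f))"
    by (auto intro!: bounded_linear_Pair bounded_linear_zero bounded_linear_ident)
  have slice: "smooth_fun_on N W (F x)" if x: "x \<in> V" for x
    unfolding smooth_fun_on_def
  proof (intro allI impI)
    fix U' \<psi> assume d: "(U', \<psi>) \<in> atlas N"
    obtain U \<phi> where c: "(U, \<phi>) \<in> atlas M" "x \<in> U"
      using M.chart_at x V openin_subset by blast
    note opn = M.chart_open_image[OF c(1) V] N.chart_open_image[OF d W]
    have "smooth_on (\<psi> ` (U' \<inter> W)) (\<lambda>w. H U \<phi> U' \<psi> ((\<phi> x, 0) + (0, w)))"
      by (rule smooth_on_compose[OF frame opn(2) open_Times[OF opn] _ H[OF c(1) d]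
            smooth_on_affine[OF opn(2) right]]) (use x c(2) in auto)
    then show "smooth_on (\<psi> ` (U' \<inter> W)) (\<lambda>w. F x (inv_into U' \<psi> w))"
      using M.chart_inj[OF c(1)] c(2) by (simp add: H_def)
  qed
  then show "x \<in> V \<Longrightarrow> smooth_fun_on N W (F x)" .
  assume D: "D \<in> tangent_space N q" and q: "q \<in> W"
  obtain U' \<psi> where d: "(U', \<psi>) \<in> atlas N" "q \<in> U'"
    using N.chart_at q W openin_subset by blast
  obtain \<xi> where \<xi>: "\<And>f. smooth_near N q f \<Longrightarrow>
      D f = frechet_derivative (\<lambda>z. f (inv_into U' \<psi> z)) (at (\<psi> q)) \<xi>"
    using N.tangent_eq_directional_derivative[OF D d] by blast
  show "smooth_fun_on M V (\<lambda>x. D (F x))"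
    unfolding smooth_fun_on_def
  proof (intro allI impI)
    fix U \<phi> assume c: "(U, \<phi>) \<in> atlas M"
    note opn = M.chart_open_image[OF c V] N.chart_open_image[OF d(1) W]
    let ?A = "\<phi> ` (U \<inter> V)" and ?B = "\<psi> ` (U' \<inter> W)"
    let ?H = "H U \<phi> U' \<psi>"
    have "smooth_on ?A (\<lambda>z. frechet_derivative ?H (at ((0, \<psi> q) + (z, 0))) (0, \<xi>))"
      by (rule smooth_on_compose[OF frame opn(1) open_Times[OF opn] _
            smooth_on_frechet_derivative[OF H[OF c d(1)]] smooth_on_affine[OF opn(1) left]])
         (use q d(2) in auto)
    moreover have "frechet_derivative ?H (at ((0, \<psi> q) + (z, 0))) (0, \<xi>) = D (F (inv_into U \<phi> z))"
      if z: "z \<in> ?A" for z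
    proof -
      have inV: "inv_into U \<phi> z \<in> V" using z M.chart_inj[OF c] by auto
      have "smooth_near N q (F (inv_into U \<phi> z))"
        using slice[OF inV] W q by (auto simp: smooth_near_iff)
      note Deq = \<xi>[OF this]
      have "(z, \<psi> q) \<in> ?A \<times> ?B" using z q d(2) by auto
      then have dH: "(?H has_derivative frechet_derivative ?H (at (z, \<psi> q))) (at (z, \<psi> q))"
        by (rule smooth_on_has_derivative[OF H[OF c d(1)]])
      have "((\<lambda>w. (z, w)) has_derivative (\<lambda>h. (0, h))) (at (\<psi> q))"
        by (auto intro!: derivative_eq_intros)
      from has_derivative_compose[OF this dH]
      have "((\<lambda>w. F (inv_into U \<phi> z) (inv_into U' \<psi> w)) has_derivative
          (\<lambda>h. frechet_derivative ?H (at (z, \<psi> q)) (0, h))) (at (\<psi> q))"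
        by (simp add: H_def)
      from frechet_derivative_at[OF this] show ?thesis
        using Deq by (metis add_0 add.right_neutral add_Pair)
    qed
    ultimately show "smooth_on ?A (\<lambda>z. D (F (inv_into U \<phi> z)))"
      by (rule smooth_on_transform[OF _ opn(1)])
  qed
qed

section \<open>The Lie algebra of a Lie group\<close>

lemma tangent_space_zero: "(\<lambda>f. 0) \<in> tangent_space M p"
  by (simp add: tangent_space_def)

lemma tangent_space_plus:
  "u \<in> tangent_space M p \<Longrightarrow> v \<in> tangent_space M p \<Longrightarrow> (\<lambda>f. u f + v f) \<in> tangent_space M p"
  by (auto simp: tangent_space_def algebra_simps)

lemma tangent_space_scale: "u \<in> tangent_space M p \<Longrightarrow> (\<lambda>f. c * u f) \<in> tangent_space M p"
  by (auto simp: tangent_space_def algebra_simps)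

lemma (in open_atlas) differential_in_tangent_space:
  fixes N :: "('b, 'f::real_inner) mfd"
  assumes N: "smooth_manifold N" and F: "smooth_map M N F" and p: "p \<in> topspace (mtop M)"
    and u: "u \<in> tangent_space M p"
  shows "differential M N F p u \<in> tangent_space N (F p)"
proof -
  interpret N: smooth_manifold N by fact
  have eq: "differential M N F p u f = u (\<lambda>x. f (F x))" if "smooth_near N (F p) f" for f
    using that by (simp add: differential_def o_def)
  note pull = smooth_near_comp[OF N F p]
  show ?thesis
    unfolding tangent_space_def
    using eq tangent_add[OF u pull pull] tangent_cmult[OF u pull] tangent_mult[OF u pull pull]
      N.smooth_near_add N.smooth_near_cmult N.smooth_near_mult
    by (simp add: differential_def)
qed

context lie_group
begin

lemma smooth_manifold_M: "smooth_manifold M" ..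

lemma one_in_topspace: "\<one> \<in> topspace (mtop M)"
  by (simp add: topspace_eq_carrier)

lemma openin_carrier: "openin (mtop M) (carrier G)"
  using openin_topspace[of "mtop M"] by (simp add: topspace_eq_carrier)

lemma continuous_left_translation:
  assumes "q \<in> carrier G"
  shows "continuous_map (mtop M) (mtop M) (\<lambda>r. q \<otimes> r)"
proof -
  have "continuous_map (prod_topology (mtop M) (mtop M)) (mtop M) (\<lambda>(x, y). x \<otimes> y)"
    using smooth_mult by (simp add: smooth_map_def prod_mfd_def)
  moreover have "continuous_map (mtop M) (prod_topology (mtop M) (mtop M)) (\<lambda>r. (q, r))"
    using assms by (intro continuous_map_pairedI) (auto simp: topspace_eq_carrier)
  ultimately have "continuous_map (mtop M) (mtop M) ((\<lambda>(x, y). x \<otimes> y) \<circ> (\<lambda>r. (q, r)))"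
    by (rule continuous_map_compose[rotated])
  then show ?thesis by (simp add: o_def)
qed

text \<open>
  Continuity and smoothness of multiplication near the pair of identities, with a square neighbourhood
  so that the two factors can be treated alike.
\<close>

lemma smooth_near_one_product:
  assumes "smooth_near M \<one> f"
  obtains V where "openin (mtop M) V" "\<one> \<in> V" "V \<subseteq> carrier G" "\<And>q. q \<in> V \<Longrightarrow> smooth_near M q f"
    "smooth_fun_on (prod_mfd M M) (V \<times> V) (\<lambda>(x, y). f (x \<otimes> y))"
proof -
  interpret P: open_atlas "prod_mfd M M"
    by (rule open_atlas_prod_mfd[OF open_atlas_axioms open_atlas_axioms])
  obtain W where W: "openin (mtop M) W" "\<one> \<in> W" "smooth_fun_on M W f"
    using assms by (auto simp: smooth_near_iff)
  define W' where "W' = {p \<in> topspace (mtop (prod_mfd M M)). (\<lambda>(x, y). x \<otimes> y) p \<in> W}"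
  have W': "openin (mtop (prod_mfd M M)) W'"
    "smooth_fun_on (prod_mfd M M) W' (\<lambda>p. f ((\<lambda>(x, y). x \<otimes> y) p))"
    unfolding W'_def by (rule P.smooth_fun_on_comp[OF smooth_manifold_M smooth_mult W(1,3)])+
  have "openin (prod_topology (mtop M) (mtop M)) W'" using W'(1) by (simp add: prod_mfd_def)
  moreover have "(\<one>, \<one>) \<in> W'"
    using W(2) by (simp add: W'_def prod_mfd_def topspace_eq_carrier)
  ultimately have "\<exists>V1 V2. openin (mtop M) V1 \<and> openin (mtop M) V2 \<and> \<one> \<in> V1 \<and> \<one> \<in> V2 \<and> V1 \<times> V2 \<subseteq> W'"
    unfolding openin_prod_topology_alt by blast
  then obtain V1 V2 where V12: "openin (mtop M) V1" "openin (mtop M) V2" "\<one> \<in> V1" "\<one> \<in> V2"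
    "V1 \<times> V2 \<subseteq> W'" by blast
  define V where "V = W \<inter> (V1 \<inter> V2)"
  have "smooth_fun_on (prod_mfd M M) (V \<times> V) (\<lambda>p. f ((\<lambda>(x, y). x \<otimes> y) p))"
    using W'(2) by (rule smooth_fun_on_subset) (use V12(5) in \<open>auto simp: V_def\<close>)
  then have "smooth_fun_on (prod_mfd M M) (V \<times> V) (\<lambda>(x, y). f (x \<otimes> y))"
    by (simp add: case_prod_unfold)
  moreover have "openin (mtop M) V" unfolding V_def using W(1) V12(1,2) by blast
  moreover have "\<one> \<in> V" using W(2) V12(3,4) by (simp add: V_def)
  moreover have "V \<subseteq> carrier G"
    using openin_subset[OF \<open>openin (mtop M) V\<close>] by (simp add: topspace_eq_carrier)
  moreover have "smooth_near M q f" if "q \<in> V" for q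
    using W that by (auto simp: V_def smooth_near_iff)
  ultimately show ?thesis using that by blast
qed

abbreviation lderiv :: "(('a \<Rightarrow> real) \<Rightarrow> real) \<Rightarrow> ('a \<Rightarrow> real) \<Rightarrow> 'a \<Rightarrow> real" where
  "lderiv u f \<equiv> \<lambda>q. left_invariant_field G M u q f"

text \<open>
  At base points \<open>q\<close> near the identity \<open>f\<close> is smooth near \<open>q\<close>, so the default value in the definition of
  the differential does not occur, and \<open>lderiv u f\<close> depends smoothly on the base point.
\<close>

lemma lderiv_near_one:
  assumes "smooth_near M \<one> f"
  obtains V where "openin (mtop M) V" "\<one> \<in> V" "V \<subseteq> carrier G"
    "\<And>q. q \<in> V \<Longrightarrow> smooth_near M q f"
    "\<And>q. q \<in> V \<Longrightarrow> smooth_near M \<one> (\<lambda>h. f (q \<otimes> h))"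
    "\<And>u q. q \<in> V \<Longrightarrow> lderiv u f q = u (\<lambda>h. f (q \<otimes> h))"
    "\<And>u. u \<in> tangent_space M \<one> \<Longrightarrow> smooth_near M \<one> (lderiv u f)"
proof -
  obtain V where V: "openin (mtop M) V" "\<one> \<in> V" "V \<subseteq> carrier G" "\<And>q. q \<in> V \<Longrightarrow> smooth_near M q f"
    and F: "smooth_fun_on (prod_mfd M M) (V \<times> V) (\<lambda>(x, y). f (x \<otimes> y))"
    using smooth_near_one_product[OF assms] by blast
  note slice = smooth_fun_on_slice[OF smooth_manifold_M smooth_manifold_M V(1) V(1) F]
    and tslice = smooth_fun_on_tangent_slice[OF smooth_manifold_M smooth_manifold_M V(1) V(1) F]
  have eq: "lderiv u f q = u (\<lambda>h. f (q \<otimes> h))" if q: "q \<in> V" for u q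
  proof -
    have "q \<otimes> \<one> = q" using q V(3) by auto
    then show ?thesis
      using V(4)[OF q] by (simp add: left_invariant_field_def differential_def o_def)
  qed
  have "smooth_near M \<one> (\<lambda>h. f (q \<otimes> h))" if "q \<in> V" for q
    using slice[OF that] V(1,2) by (auto simp: smooth_near_iff)
  moreover have "smooth_near M \<one> (lderiv u f)" if u: "u \<in> tangent_space M \<one>" for u
  proof -
    have "smooth_fun_on M V (\<lambda>q. u (\<lambda>h. f (q \<otimes> h)))" using tslice[OF u V(2)] .
    then have "smooth_fun_on M V (lderiv u f)"
      using smooth_fun_on_cong[OF V(1), of "lderiv u f" "\<lambda>q. u (\<lambda>h. f (q \<otimes> h))"] eq by simp
    then show ?thesis using V(1,2) by (auto simp: smooth_near_iff)
  qed
  ultimately show ?thesis using that[OF V(1-3)] V(4) eq by blast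
qed

lemma smooth_lderiv:
  "u \<in> tangent_space M \<one> \<Longrightarrow> smooth_near M \<one> f \<Longrightarrow> smooth_near M \<one> (lderiv u f)"
  by (rule lderiv_near_one)

lemma lderiv_one:
  assumes u: "u \<in> tangent_space M \<one>" and f: "smooth_near M \<one> f"
  shows "lderiv u f \<one> = u f"
proof -
  have "lderiv u f \<one> = u (\<lambda>h. f (\<one> \<otimes> h))"
    using lderiv_near_one[OF f] by metis
  also have "\<dots> = u f"
    by (rule tangent_cong[OF u openin_carrier]) auto
  finally show ?thesis .
qed

lemma lie_bracket_eq:
  assumes "u \<in> tangent_space M \<one>" "v \<in> tangent_space M \<one>" "smooth_near M \<one> f"
  shows "lie_bracket G M u v f = u (lderiv v f) - v (lderiv u f)"
  using assms by (simp add: lie_bracket_def vector_field_bracket_def lderiv_one smooth_lderiv)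

lemma lie_bracket_not_smooth: "\<not> smooth_near M \<one> f \<Longrightarrow> lie_bracket G M u v f = 0"
  by (simp add: lie_bracket_def vector_field_bracket_def)

lemma tangent_lderiv_cmult:
  assumes w: "w \<in> tangent_space M \<one>" and u: "u \<in> tangent_space M \<one>"
    and f: "smooth_near M \<one> f"
  shows "w (lderiv u (\<lambda>x. c * f x)) = c * w (lderiv u f)"
proof -
  obtain V where V: "openin (mtop M) V" "\<one> \<in> V"
    "\<And>q. q \<in> V \<Longrightarrow> smooth_near M \<one> (\<lambda>h. f (q \<otimes> h))"
    "\<And>q. q \<in> V \<Longrightarrow> lderiv u f q = u (\<lambda>h. f (q \<otimes> h))"
    using lderiv_near_one[OF f] by metis
  obtain V' where V': "openin (mtop M) V'" "\<one> \<in> V'"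
    "\<And>q. q \<in> V' \<Longrightarrow> lderiv u (\<lambda>x. c * f x) q = u (\<lambda>h. c * f (q \<otimes> h))"
    using lderiv_near_one[OF smooth_near_cmult[OF f]] by metis
  have "openin (mtop M) (V \<inter> V')" using V(1) V'(1) by blast
  then have "w (lderiv u (\<lambda>x. c * f x)) = w (\<lambda>q. c * lderiv u f q)"
    by (rule tangent_cong[OF w]) (use V V' tangent_cmult[OF u] in auto)
  then show ?thesis using tangent_cmult[OF w smooth_lderiv[OF u f]] by simp
qed

text \<open>
  The two mixed terms of the product rule, \<open>u g * w f\<close> and \<open>u f * w g\<close>, are together symmetric in \<open>u\<close> and \<open>w\<close>;
  this is why they disappear from the bracket.
\<close>

lemma tangent_of_lderiv:
  assumes w: "w \<in> tangent_space M \<one>" and u: "u \<in> tangent_space M \<one>"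
    and f: "smooth_near M \<one> f" and g: "smooth_near M \<one> g"
  shows tangent_lderiv_add: "w (lderiv u (\<lambda>x. f x + g x)) = w (lderiv u f) + w (lderiv u g)"
    and tangent_lderiv_mult: "w (lderiv u (\<lambda>x. f x * g x)) =
      f \<one> * w (lderiv u g) + u g * w f + g \<one> * w (lderiv u f) + u f * w g"
proof -
  obtain V1 where V1: "openin (mtop M) V1" "\<one> \<in> V1" "V1 \<subseteq> carrier G"
    "\<And>q. q \<in> V1 \<Longrightarrow> smooth_near M \<one> (\<lambda>h. f (q \<otimes> h))"
    "\<And>q. q \<in> V1 \<Longrightarrow> lderiv u f q = u (\<lambda>h. f (q \<otimes> h))"
    using lderiv_near_one[OF f] by metis
  obtain V2 where V2: "openin (mtop M) V2" "\<one> \<in> V2"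
    "\<And>q. q \<in> V2 \<Longrightarrow> smooth_near M \<one> (\<lambda>h. g (q \<otimes> h))"
    "\<And>q. q \<in> V2 \<Longrightarrow> lderiv u g q = u (\<lambda>h. g (q \<otimes> h))"
    using lderiv_near_one[OF g] by metis
  \<comment> \<open>\<open>w\<close> sees only the germ, so \<open>lderiv u k\<close> may be computed from its formula near the identity.\<close>
  have loc: "w (lderiv u k) = w k'" if k: "smooth_near M \<one> k"
    and "\<And>q. q \<in> V1 \<inter> V2 \<Longrightarrow> u (\<lambda>h. k (q \<otimes> h)) = k' q" for k k'
  proof -
    obtain V where V: "openin (mtop M) V" "\<one> \<in> V"
      "\<And>q. q \<in> V \<Longrightarrow> lderiv u k q = u (\<lambda>h. k (q \<otimes> h))"
      using lderiv_near_one[OF k] by metis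
    have "openin (mtop M) (V \<inter> (V1 \<inter> V2))" using V(1) V1(1) V2(1) by blast
    then show ?thesis
      by (rule tangent_cong[OF w]) (use V V1(2) V2(2) that(2) in auto)
  qed
  note sf = smooth_lderiv[OF u f] and sg = smooth_lderiv[OF u g]
  have "w (lderiv u (\<lambda>x. f x + g x)) = w (\<lambda>q. lderiv u f q + lderiv u g q)"
    by (rule loc[OF smooth_near_add[OF f g]]) (use V1 V2 tangent_add[OF u] in auto)
  then show "w (lderiv u (\<lambda>x. f x + g x)) = w (lderiv u f) + w (lderiv u g)"
    using tangent_add[OF w sf sg] by simp
  have "w (lderiv u (\<lambda>x. f x * g x)) = w (\<lambda>q. f q * lderiv u g q + g q * lderiv u f q)"
  proof (rule loc[OF smooth_near_mult[OF f g]])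
    fix q assume q: "q \<in> V1 \<inter> V2"
    then have "q \<otimes> \<one> = q" using V1(3) by auto
    then show "u (\<lambda>h. f (q \<otimes> h) * g (q \<otimes> h)) = f q * lderiv u g q + g q * lderiv u f q"
      using tangent_mult[OF u, of "\<lambda>h. f (q \<otimes> h)" "\<lambda>h. g (q \<otimes> h)"] V1 V2 q by simp
  qed
  also have "\<dots> = w (\<lambda>q. f q * lderiv u g q) + w (\<lambda>q. g q * lderiv u f q)"
    by (rule tangent_add[OF w smooth_near_mult[OF f sg] smooth_near_mult[OF g sf]])
  finally show "w (lderiv u (\<lambda>x. f x * g x)) =
      f \<one> * w (lderiv u g) + u g * w f + g \<one> * w (lderiv u f) + u f * w g"
    using tangent_mult[OF w f sg] tangent_mult[OF w g sf] lderiv_one[OF u] f g by simp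
qed

lemma lie_bracket_closed:
  assumes u: "u \<in> tangent_space M \<one>" and v: "v \<in> tangent_space M \<one>"
  shows "lie_bracket G M u v \<in> tangent_space M \<one>"
  unfolding tangent_space_def
proof (intro CollectI conjI allI impI)
  fix f g and c :: real
  show "\<not> smooth_near M \<one> f \<Longrightarrow> lie_bracket G M u v f = 0" by (rule lie_bracket_not_smooth)
  assume f: "smooth_near M \<one> f"
  show "lie_bracket G M u v (\<lambda>x. c * f x) = c * lie_bracket G M u v f"
    using lie_bracket_eq[OF u v] f smooth_near_cmult[OF f]
      tangent_lderiv_cmult[OF u v f] tangent_lderiv_cmult[OF v u f] by (simp add: right_diff_distrib)
  assume g: "smooth_near M \<one> g"
  show "lie_bracket G M u v (\<lambda>x. f x + g x) = lie_bracket G M u v f + lie_bracket G M u v g"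
    using lie_bracket_eq[OF u v] f g smooth_near_add[OF f g]
      tangent_lderiv_add[OF u v f g] tangent_lderiv_add[OF v u f g] by simp
  show "lie_bracket G M u v (\<lambda>x. f x * g x) = f \<one> * lie_bracket G M u v g + g \<one> * lie_bracket G M u v f"
    by (simp add: lie_bracket_eq[OF u v] f g smooth_near_mult tangent_lderiv_mult[OF u v f g]
        tangent_lderiv_mult[OF v u f g] algebra_simps)
qed

lemma lie_bracket_antisym:
  "lie_bracket G M u v f = - lie_bracket G M v u f"
  by (simp add: lie_bracket_def vector_field_bracket_def)

lemma lderiv_plus: "lderiv (\<lambda>f. u f + v f) f = (\<lambda>q. lderiv u f q + lderiv v f q)"
  by (auto simp: left_invariant_field_def differential_def)

lemma lderiv_scale: "lderiv (\<lambda>f. c * u f) f = (\<lambda>q. c * lderiv u f q)"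
  by (auto simp: left_invariant_field_def differential_def)

lemma lie_bracket_plus_left:
  assumes u: "u \<in> tangent_space M \<one>" and v: "v \<in> tangent_space M \<one>" and w: "w \<in> tangent_space M \<one>"
  shows "lie_bracket G M (\<lambda>f. u f + v f) w = (\<lambda>f. lie_bracket G M u w f + lie_bracket G M v w f)"
proof
  fix f
  show "lie_bracket G M (\<lambda>f. u f + v f) w f = lie_bracket G M u w f + lie_bracket G M v w f"
  proof (cases "smooth_near M \<one> f")
    case True
    then show ?thesis
      using lie_bracket_eq[OF tangent_space_plus[OF u v] w] lie_bracket_eq[OF u w] lie_bracket_eq[OF v w]
        tangent_add[OF w smooth_lderiv[OF u] smooth_lderiv[OF v]] by (simp add: lderiv_plus)
  qed (simp add: lie_bracket_not_smooth)
qed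

lemma lie_bracket_scale_left:
  assumes u: "u \<in> tangent_space M \<one>" and w: "w \<in> tangent_space M \<one>"
  shows "lie_bracket G M (\<lambda>f. c * u f) w = (\<lambda>f. c * lie_bracket G M u w f)"
proof
  fix f
  show "lie_bracket G M (\<lambda>f. c * u f) w f = c * lie_bracket G M u w f"
  proof (cases "smooth_near M \<one> f")
    case True
    then show ?thesis
      using lie_bracket_eq[OF tangent_space_scale[OF u] w] lie_bracket_eq[OF u w]
        tangent_cmult[OF w smooth_lderiv[OF u]] by (simp add: lderiv_scale right_diff_distrib)
  qed (simp add: lie_bracket_not_smooth)
qed

text \<open>
  Left invariance of \<open>lderiv v\<close>, which is associativity of the group: \<open>f((q r) h) = f(q (r h))\<close>. The
  neighbourhood must keep the product \<open>q r\<close> in the region where \<open>f\<close> is smooth, hence the continuity of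
  left translation.
\<close>

lemma lderiv_left_translate:
  assumes v: "v \<in> tangent_space M \<one>" and f: "smooth_near M \<one> f"
  obtains V where "openin (mtop M) V" "\<one> \<in> V"
    "\<And>u q. u \<in> tangent_space M \<one> \<Longrightarrow> q \<in> V \<Longrightarrow> lderiv u (lderiv v f) q = u (lderiv v (\<lambda>h. f (q \<otimes> h)))"
proof -
  obtain V0 where V0: "openin (mtop M) V0" "\<one> \<in> V0" "V0 \<subseteq> carrier G"
    "\<And>q. q \<in> V0 \<Longrightarrow> smooth_near M \<one> (\<lambda>h. f (q \<otimes> h))"
    "\<And>q. q \<in> V0 \<Longrightarrow> lderiv v f q = v (\<lambda>h. f (q \<otimes> h))"
    using lderiv_near_one[OF f] by metis
  obtain V1 where V1: "openin (mtop M) V1" "\<one> \<in> V1"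
    "\<And>u q. q \<in> V1 \<Longrightarrow> lderiv u (lderiv v f) q = u (\<lambda>r. lderiv v f (q \<otimes> r))"
    using lderiv_near_one[OF smooth_lderiv[OF v f]] by metis
  have "lderiv u (lderiv v f) q = u (lderiv v (\<lambda>h. f (q \<otimes> h)))"
    if u: "u \<in> tangent_space M \<one>" and q: "q \<in> V0 \<inter> V1" for u q
  proof -
    have qG: "q \<in> carrier G" using q V0(3) by blast
    obtain Vq where Vq: "openin (mtop M) Vq" "\<one> \<in> Vq" "Vq \<subseteq> carrier G"
      "\<And>r. r \<in> Vq \<Longrightarrow> lderiv v (\<lambda>h. f (q \<otimes> h)) r = v (\<lambda>h. f (q \<otimes> (r \<otimes> h)))"
      using lderiv_near_one[OF V0(4)[of q]] q by (metis IntD1)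
    define R where "R = Vq \<inter> {r \<in> topspace (mtop M). q \<otimes> r \<in> V0}"
    have R: "openin (mtop M) R" "\<one> \<in> R"
      unfolding R_def
      using Vq(1,2) openin_continuous_map_preimage[OF continuous_left_translation[OF qG] V0(1)] q qG one_in_topspace
      by auto
    have "lderiv v f (q \<otimes> r) = lderiv v (\<lambda>h. f (q \<otimes> h)) r" if r: "r \<in> R" for r
    proof -
      have rG: "r \<in> carrier G" and qr: "q \<otimes> r \<in> V0" and rq: "r \<in> Vq"
        using r Vq(3) by (auto simp: R_def)
      have "v (\<lambda>h. f (q \<otimes> r \<otimes> h)) = v (\<lambda>h. f (q \<otimes> (r \<otimes> h)))"
        by (rule tangent_cong[OF v openin_carrier one_closed]) (simp add: m_assoc qG rG)
      then show ?thesis using V0(5)[OF qr] Vq(4)[OF rq] by simp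
    qed
    then have "u (\<lambda>r. lderiv v f (q \<otimes> r)) = u (lderiv v (\<lambda>h. f (q \<otimes> h)))"
      by (rule tangent_cong[OF u R])
    then show ?thesis using V1(3)[of q u] q by simp
  qed
  moreover have "openin (mtop M) (V0 \<inter> V1)" "\<one> \<in> V0 \<inter> V1" using V0 V1 by auto
  ultimately show ?thesis using that by blast
qed

text \<open>
  The left invariant field of the bracket is the commutator of the left invariant fields: at \<open>q\<close>, both
  evaluate the bracket on the translate \<open>h \<mapsto> f(q h)\<close>.
\<close>

lemma tangent_lderiv_lie_bracket:
  assumes u: "u \<in> tangent_space M \<one>" and v: "v \<in> tangent_space M \<one>" and w: "w \<in> tangent_space M \<one>"
    and f: "smooth_near M \<one> f"
  shows "u (lderiv (lie_bracket G M v w) f) = u (lderiv v (lderiv w f)) - u (lderiv w (lderiv v f))"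
proof -
  obtain V0 where V0: "openin (mtop M) V0" "\<one> \<in> V0"
    "\<And>q. q \<in> V0 \<Longrightarrow> smooth_near M \<one> (\<lambda>h. f (q \<otimes> h))"
    "\<And>u q. q \<in> V0 \<Longrightarrow> lderiv u f q = u (\<lambda>h. f (q \<otimes> h))"
    using lderiv_near_one[OF f] by metis
  obtain V1 where V1: "openin (mtop M) V1" "\<one> \<in> V1"
    "\<And>u q. u \<in> tangent_space M \<one> \<Longrightarrow> q \<in> V1 \<Longrightarrow> lderiv u (lderiv v f) q = u (lderiv v (\<lambda>h. f (q \<otimes> h)))"
    using lderiv_left_translate[OF v f] by metis
  obtain V2 where V2: "openin (mtop M) V2" "\<one> \<in> V2"
    "\<And>u q. u \<in> tangent_space M \<one> \<Longrightarrow> q \<in> V2 \<Longrightarrow> lderiv u (lderiv w f) q = u (lderiv w (\<lambda>h. f (q \<otimes> h)))"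
    using lderiv_left_translate[OF w f] by metis
  have "u (lderiv (lie_bracket G M v w) f) = u (\<lambda>q. lderiv v (lderiv w f) q - lderiv w (lderiv v f) q)"
  proof (rule tangent_cong[OF u])
    show "openin (mtop M) (V0 \<inter> (V1 \<inter> V2))" "\<one> \<in> V0 \<inter> (V1 \<inter> V2)" using V0 V1 V2 by auto
    fix q assume q: "q \<in> V0 \<inter> (V1 \<inter> V2)"
    then show "lderiv (lie_bracket G M v w) f q = lderiv v (lderiv w f) q - lderiv w (lderiv v f) q"
      using V0(4)[of q] lie_bracket_eq[OF v w V0(3)[of q]] V1(3)[OF w, of q] V2(3)[OF v, of q] by simp
  qed
  also have "\<dots> = u (lderiv v (lderiv w f)) - u (lderiv w (lderiv v f))"
    by (intro tangent_diff[OF u] smooth_lderiv v w f)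
  finally show ?thesis .
qed

text \<open>
  In this form the Jacobi identity is a cancellation of the twelve terms of the cyclic sum.
\<close>

lemma lie_bracket_nested:
  assumes u: "u \<in> tangent_space M \<one>" and v: "v \<in> tangent_space M \<one>" and w: "w \<in> tangent_space M \<one>"
    and f: "smooth_near M \<one> f"
  shows "lie_bracket G M u (lie_bracket G M v w) f =
    u (lderiv v (lderiv w f)) - u (lderiv w (lderiv v f)) - v (lderiv w (lderiv u f)) + w (lderiv v (lderiv u f))"
  using lie_bracket_eq[OF u lie_bracket_closed[OF v w] f] tangent_lderiv_lie_bracket[OF u v w f]
    lie_bracket_eq[OF v w smooth_lderiv[OF u f]] by simp

lemma lie_bracket_jacobi:
  assumes u: "u \<in> tangent_space M \<one>" and v: "v \<in> tangent_space M \<one>" and w: "w \<in> tangent_space M \<one>"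
  shows "lie_bracket G M u (lie_bracket G M v w) f + lie_bracket G M v (lie_bracket G M w u) f +
    lie_bracket G M w (lie_bracket G M u v) f = 0"
proof (cases "smooth_near M \<one> f")
  case True
  then show ?thesis
    using lie_bracket_nested[OF u v w] lie_bracket_nested[OF v w u] lie_bracket_nested[OF w u v] by simp
qed (simp add: lie_bracket_not_smooth)

lemma lie_algebra_tangent_module:
  "lie_algebra (ring_of_type_algebra :: real ring) (tangent_module M \<one>) (lie_bracket G M)"
proof -
  have field: "field (ring_of_type_algebra :: real ring)" by (rule field_from_type_algebra)
  have cring: "cring (ring_of_type_algebra :: real ring)" using field by (simp add: field_def domain_def)
  have ab: "abelian_group (tangent_module M \<one>)"
  proof (rule abelian_groupI)
    fix x assume "x \<in> carrier (tangent_module M \<one>)"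
    then show "\<exists>y\<in>carrier (tangent_module M \<one>). y \<oplus>\<^bsub>tangent_module M \<one>\<^esub> x = \<zero>\<^bsub>tangent_module M \<one>\<^esub>"
      using tangent_space_scale[of x M \<one> "-1"]
      by (intro bexI[of _ "\<lambda>f. -1 * x f"]) (auto simp: tangent_module_def)
  qed (auto simp: tangent_module_def tangent_space_zero tangent_space_plus)
  have mod: "Module.module (ring_of_type_algebra :: real ring) (tangent_module M \<one>)"
    by (rule moduleI[OF cring ab])
       (auto simp: tangent_module_def tangent_space_scale ring_of_type_algebra_def algebra_simps)
  interpret F: field "ring_of_type_algebra :: real ring" by (rule field)
  interpret L: Module.module "ring_of_type_algebra :: real ring" "tangent_module M \<one>" by (rule mod)
  have anti: "lie_bracket G M u v = (\<lambda>f. -1 * lie_bracket G M v u f)" for u v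
    using lie_bracket_antisym[of u v] by auto
  have "lie_bracket G M u u = (\<lambda>f. 0)" for u
    by (auto simp: lie_bracket_def vector_field_bracket_def)
  moreover have "lie_bracket G M u (\<lambda>f. v f + w f) = (\<lambda>f. lie_bracket G M u v f + lie_bracket G M u w f)"
    if "u \<in> tangent_space M \<one>" "v \<in> tangent_space M \<one>" "w \<in> tangent_space M \<one>" for u v w
    using lie_bracket_plus_left[OF that(2,3,1)] by (simp add: anti[of u])
  moreover have "lie_bracket G M u (\<lambda>f. c * v f) = (\<lambda>f. c * lie_bracket G M u v f)"
    if "u \<in> tangent_space M \<one>" "v \<in> tangent_space M \<one>" for u v c
    using lie_bracket_scale_left[OF that(2,1)] by (simp add: anti[of u])
  ultimately show ?thesis
    by unfold_locales
      (simp_all add: tangent_module_def lie_bracket_closed lie_bracket_plus_left lie_bracket_scale_left lie_bracket_jacobi)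
qed

end

section \<open>The averaging identity\<close>

context averaging_lie_group
begin

lemma averaging_differential_apply:
  assumes "Av \<one> = \<one>" "smooth_near M \<one> f"
  shows "differential M M Av \<one> u f = u (\<lambda>x. f (Av x))"
  using assms by (simp add: differential_def o_def)

lemma averaging_preimage_open:
  assumes "Av \<one> = \<one>" "openin (mtop M) V" "\<one> \<in> V"
  shows "openin (mtop M) {x \<in> carrier G. Av x \<in> V}" "\<one> \<in> {x \<in> carrier G. Av x \<in> V}"
  using openin_continuous_map_preimage[of "mtop M" "mtop M" Av V] averaging_smooth assms
  by (auto simp: smooth_map_def topspace_eq_carrier)

text \<open>
  Both sides, applied to \<open>f\<close>, are compared with \<open>u\<^sub>x v\<^sub>y f(Av x \<otimes> Av y) - v\<^sub>x u\<^sub>y f(Av x \<otimes> Av y)\<close>. On the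
  right-hand side the first term uses \<open>Av (Av x \<otimes> y) = Av x \<otimes> Av y\<close> and the second one
  \<open>Av (x \<otimes> Av y) = Av x \<otimes> Av y\<close>.
\<close>

lemma averaging_bracket_identity:
  assumes one: "Av \<one> = \<one>" and u: "u \<in> tangent_space M \<one>" and v: "v \<in> tangent_space M \<one>"
  defines "A \<equiv> differential M M Av \<one>"
  shows "lie_bracket G M (A u) (A v) = A (lie_bracket G M (A u) v)"
proof
  fix f
  have A_closed: "A x \<in> tangent_space M \<one>" if "x \<in> tangent_space M \<one>" for x
    using differential_in_tangent_space[OF smooth_manifold_M averaging_smooth one_in_topspace that]
    by (simp add: A_def one)
  note A_apply = averaging_differential_apply[OF one, folded A_def]
  show "lie_bracket G M (A u) (A v) f = A (lie_bracket G M (A u) v) f"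
  proof (cases "smooth_near M \<one> f")
    case f: True
    define g where "g = (\<lambda>x. f (Av x))"
    have g: "smooth_near M \<one> g"
      using smooth_near_comp[OF smooth_manifold_M averaging_smooth one_in_topspace, of f] f
      by (simp add: one g_def)
    obtain V where V: "openin (mtop M) V" "\<one> \<in> V"
      "\<And>q. q \<in> V \<Longrightarrow> smooth_near M \<one> (\<lambda>h. f (q \<otimes> h))"
      "\<And>u q. q \<in> V \<Longrightarrow> lderiv u f q = u (\<lambda>h. f (q \<otimes> h))"
      using lderiv_near_one[OF f] by metis
    obtain W where W: "openin (mtop M) W" "\<one> \<in> W" "W \<subseteq> carrier G"
      "\<And>q. q \<in> W \<Longrightarrow> smooth_near M \<one> (\<lambda>h. g (q \<otimes> h))"
      "\<And>u q. q \<in> W \<Longrightarrow> lderiv u g q = u (\<lambda>h. g (q \<otimes> h))"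
      using lderiv_near_one[OF g] by metis
    note preV = averaging_preimage_open[OF one V(1,2)] and preW = averaging_preimage_open[OF one W(1,2)]
    have AA: "A s (lderiv (A t) f) = s (\<lambda>x. t (\<lambda>y. f (Av x \<otimes> Av y)))"
      if s: "s \<in> tangent_space M \<one>" and t: "t \<in> tangent_space M \<one>" for s t
    proof -
      have "A s (lderiv (A t) f) = s (\<lambda>x. lderiv (A t) f (Av x))"
        by (rule A_apply[OF smooth_lderiv[OF A_closed[OF t] f]])
      also have "\<dots> = s (\<lambda>x. t (\<lambda>y. f (Av x \<otimes> Av y)))"
        by (rule tangent_cong[OF s preV]) (use V(3,4) A_apply in auto)
      finally show ?thesis .
    qed
    have "A u (lderiv v g) = u (\<lambda>x. lderiv v g (Av x))"
      by (rule A_apply[OF smooth_lderiv[OF v g]])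
    also have "\<dots> = u (\<lambda>x. v (\<lambda>y. f (Av x \<otimes> Av y)))"
    proof (rule tangent_cong[OF u preW])
      fix x assume x: "x \<in> {x \<in> carrier G. Av x \<in> W}"
      have "v (\<lambda>y. g (Av x \<otimes> y)) = v (\<lambda>y. f (Av x \<otimes> Av y))"
        by (rule tangent_cong[OF v openin_carrier one_closed]) (use x averaging_left in \<open>simp add: g_def\<close>)
      then show "lderiv v g (Av x) = v (\<lambda>y. f (Av x \<otimes> Av y))" using W(5) x by simp
    qed
    finally have 1: "A u (lderiv v g) = u (\<lambda>x. v (\<lambda>y. f (Av x \<otimes> Av y)))" .
    have 2: "v (lderiv (A u) g) = v (\<lambda>x. u (\<lambda>y. f (Av x \<otimes> Av y)))"
    proof (rule tangent_cong[OF v W(1,2)])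
      fix x assume x: "x \<in> W"
      have "lderiv (A u) g x = u (\<lambda>y. g (x \<otimes> Av y))"
        using W(4,5)[OF x] A_apply by simp
      also have "\<dots> = u (\<lambda>y. f (Av x \<otimes> Av y))"
        by (rule tangent_cong[OF u openin_carrier one_closed]) (use x W(3) averaging_right in \<open>auto simp: g_def\<close>)
      finally show "lderiv (A u) g x = u (\<lambda>y. f (Av x \<otimes> Av y))" .
    qed
    show ?thesis
      using lie_bracket_eq[OF A_closed[OF u] A_closed[OF v] f] lie_bracket_eq[OF A_closed[OF u] v g]
        AA[OF u v] AA[OF v u] 1 2 A_apply[OF f] by (simp add: g_def)
  next
    case False
    then show ?thesis by (simp add: lie_bracket_not_smooth A_def differential_def one)
  qed
qed

end

theorem theorem3p10:
  fixes G :: "('a, 'm) monoid_scheme" and M :: "('a, 'e::real_inner) mfd" and Av :: "'a \<Rightarrow> 'a"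
  assumes "averaging_lie_group G M Av"
    and "Av \<one>\<^bsub>G\<^esub> = \<one>\<^bsub>G\<^esub>"
  shows "averaging_lie_algebra (ring_of_type_algebra :: real ring)
           (tangent_module M \<one>\<^bsub>G\<^esub>) (lie_bracket G M) (differential M M Av \<one>\<^bsub>G\<^esub>)"
proof -
  interpret averaging_lie_group G M Av by fact
  interpret lie_algebra "ring_of_type_algebra :: real ring" "tangent_module M \<one>\<^bsub>G\<^esub>" "lie_bracket G M"
    by (rule lie_algebra_tangent_module)
  show ?thesis
  proof
    show "differential M M Av \<one>\<^bsub>G\<^esub> \<in> carrier (tangent_module M \<one>\<^bsub>G\<^esub>) \<rightarrow> carrier (tangent_module M \<one>\<^bsub>G\<^esub>)"
      using differential_in_tangent_space[OF smooth_manifold_M averaging_smooth one_in_topspace]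
      by (auto simp: tangent_module_def assms(2))
    fix x y assume "x \<in> carrier (tangent_module M \<one>\<^bsub>G\<^esub>)" "y \<in> carrier (tangent_module M \<one>\<^bsub>G\<^esub>)"
    then show "lie_bracket G M (differential M M Av \<one>\<^bsub>G\<^esub> x) (differential M M Av \<one>\<^bsub>G\<^esub> y) =
        differential M M Av \<one>\<^bsub>G\<^esub> (lie_bracket G M (differential M M Av \<one>\<^bsub>G\<^esub> x) y)"
      using averaging_bracket_identity[OF assms(2)] by (simp add: tangent_module_def)
  qed (auto simp: tangent_module_def differential_def)
qed

end
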